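(* Let $N,d\ge 1$ be integers and let $a<0<b$ be real numbers. Let $x_{ij}$, $1\le i\le N$, $1\le j\le d$, be independent, identically distributed real random variables whose common law is an atomless probability measure $P$ with $x_{ij}\in[a,b]$ almost surely. Write $m_k=\mathbb{E}\{x_{ij}^k\}=\int x^k\,dP$ for $k=1,2,3,4$ (these are finite), and assume $m_1=0$. Let $\mathbf{p}_i=(x_{i1},\dots,x_{id})^T\in[a,b]^d$ for $1\le i\le N$, and let $\boldsymbol{\Delta}\in\mathbb{R}^{N\times N}$ be the associated Euclidean distance matrix, $\boldsymbol{\Delta}(i,j)=\|\mathbf{p}_i-\mathbf{p}_j\|_2^2$. Put $c=\max\{|a|,|b|\}$ and $$\alpha_0=(m_4m_2-m_2^3-m_3^2)\,d,$$ $$\alpha_1=-m_2^3d^2+(m_2^3+m_3^2+m_2^2-m_4-m_4m_2)\,d-m_2,$$ $$\alpha_2=m_2^2d^2+(m_4-m_2^2)\,d+m_2+1,\qquad \alpha_3=-1.$$ Then the three solutions $\lambda_1,\lambda_2,\lambda_3$ (counted with multiplicity) of the cubic equation $\alpha_0+\alpha_1\lambda+\alpha_2\lambda^2+\alpha_3\lambda^3=0$ are real and positive. Set $$\lambda^*=\min\{\lambda_1,\lambda_2,\lambda_3,m_2\},\qquad \theta=\frac{1+dc^2+d^2c^4}{\lambda^*}.$$ Let $t\in(0,1)$ and $\gamma\in(0,1]$. If $$N\ \ge\ \frac{2\theta\left(\log(d+2)-\log\gamma\right)}{(1-t)^2},$$ then, with probability at least $1-\gamma$, the matrix $\boldsymbol{\Delta}$,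 with worst-case rank $r=d+2$, obeys assumptions $\mathbf{A0}$ and $\mathbf{A1}$ with $$\mu_0=\frac{\theta}{t(d+2)}\qquad\text{and}\qquad \mu_1=\frac{\theta}{t\sqrt{d+2}}.$$
   Context: For a subspace $U\subseteq\mathbb{R}^N$ of dimension $r$, with orthogonal projection $\mathbf{P}_U$ onto $U$ and standard basis $\mathbf{e}_1,\dots,\mathbf{e}_N$ of $\mathbb{R}^N$, the coherence of $U$ is $$\mu(U)=\frac{N}{r}\max_{1\le i\le N}\|\mathbf{P}_U\mathbf{e}_i\|_2^2 .$$ Let $\mathbf{M}\in\mathbb{R}^{K\times L}$ have rank $r$, with compact singular value decomposition $\mathbf{M}=\sum_{i=1}^r\sigma_i\mathbf{u}_i\mathbf{v}_i^T$, and let $U=\mathrm{span}\{\mathbf{u}_i\}$ and $V=\mathrm{span}\{\mathbf{v}_i\}$ be its column and row spaces. For positive constants $\mu_0,\mu_1$, the assumptions are: $\mathbf{A0}$: $\max\{\mu(U),\mu(V)\}\le\mu_0$. $\mathbf{A1}$: $\left\|\sum_{i=1}^r\mathbf{u}_i\mathbf{v}_i^T\right\|_\infty\le\mu_1\sqrt{\dfrac{r}{KL}}$, where $\|\cdot\|_\infty$ denotes the largest absolute value of an entry. Every Euclidean distance matrix of $N$ points in $\mathbb{R}^d$ has rank at most $d+2$; "worst-case rank $r=d+2$" means that the normalizing factor $r$ in $\mathbf{A0}$ and $\mathbf{A1}$ for $\mathbf{M}=\boldsymbol{\Delta}$ (with $K=L=N$) is $d+2$. *)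

theory Defs
  imports "HOL-Probability.Probability"
begin

definition atomless :: "'a measure \<Rightarrow> bool" where
  "atomless P \<longleftrightarrow> (\<forall>A\<in>sets P. 0 < emeasure P A \<longrightarrow>
     (\<exists>B\<in>sets P. B \<subseteq> A \<and> 0 < emeasure P B \<and> emeasure P B < emeasure P A))"

definition orth_proj :: "'a::euclidean_space set \<Rightarrow> 'a \<Rightarrow> 'a" where
  "orth_proj U x = (THE y. y \<in> U \<and> (\<forall>z\<in>U. orthogonal (x - y) z))"

text \<open>The normalizing factor \<open>r\<close> is a separate argument: the usual coherence of a
  subspace \<open>U\<close> is \<open>coherence (dim U) U\<close>, but \<open>r\<close> may also be a worst-case dimension.\<close>

definition coherence :: "nat \<Rightarrow> (real ^ 'n) set \<Rightarrow> real" where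
  "coherence r U = real CARD('n) / real r * (MAX i. (norm (orth_proj U (axis i 1)))\<^sup>2)"

definition outer :: "real ^ 'k \<Rightarrow> real ^ 'l \<Rightarrow> real ^ 'l ^ 'k" where
  "outer u v = (\<chi> i j. u $ i * v $ j)"

text \<open>Only the values of \<open>s\<close>, \<open>u\<close>, \<open>v\<close> at indices below \<open>q = rank M\<close> matter. The singular
  values are not required to be sorted.\<close>

definition compact_svd ::
  "real ^ 'l ^ 'k \<Rightarrow> nat \<Rightarrow> (nat \<Rightarrow> real) \<Rightarrow> (nat \<Rightarrow> real ^ 'k) \<Rightarrow> (nat \<Rightarrow> real ^ 'l) \<Rightarrow> bool" where
  "compact_svd M q s u v \<longleftrightarrow>
     q = rank M \<and>
     (\<forall>i<q. 0 < s i) \<and>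
     (\<forall>i<q. \<forall>j<q. u i \<bullet> u j = (if i = j then 1 else 0)) \<and>
     (\<forall>i<q. \<forall>j<q. v i \<bullet> v j = (if i = j then 1 else 0)) \<and>
     M = (\<Sum>i<q. s i *\<^sub>R outer (u i) (v i))"

definition max_entry :: "real ^ 'l ^ 'k \<Rightarrow> real" where
  "max_entry M = Max {\<bar>M $ i $ j\<bar> | i j. True}"

definition A0 :: "nat \<Rightarrow> real \<Rightarrow> real ^ 'l ^ 'k \<Rightarrow> bool" where
  "A0 r mu0 M \<longleftrightarrow>
     max (coherence r (span (columns M))) (coherence r (span (rows M))) \<le> mu0"

text \<open>The matrix \<open>\<Sum>i<q. outer (u i) (v i)\<close> is the same for every compact singular value
  decomposition of \<open>M\<close>, so the universal quantifier makes no choice. It has \<open>rank M\<close> summands,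
  whereas \<open>r\<close> is only the normalizing factor.\<close>

definition A1 :: "nat \<Rightarrow> real \<Rightarrow> real ^ 'l ^ 'k \<Rightarrow> bool" where
  "A1 r mu1 M \<longleftrightarrow>
     (\<forall>q s u v. compact_svd M q s u v \<longrightarrow>
        max_entry (\<Sum>i<q. outer (u i) (v i))
          \<le> mu1 * sqrt (real r / (real CARD('k) * real CARD('l))))"

definition edm :: "('n \<Rightarrow> real ^ 'd) \<Rightarrow> real ^ 'n ^ 'n" where
  "edm p = (\<chi> i j. (norm (p i - p j))\<^sup>2)"

lemma outer_mult_vec: "outer u v *v x = (v \<bullet> x) *\<^sub>R u"
  by (simp add: outer_def matrix_vector_mult_def vec_eq_iff inner_vec_def sum_distrib_left
      sum_distrib_right mult_ac)

lemma sum_matrix_vector_mult: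
  fixes F :: "'i \<Rightarrow> real ^ 'l ^ 'k"
  shows "(\<Sum>i\<in>S. F i) *v x = (\<Sum>i\<in>S. F i *v x)"
  by (induction S rule: infinite_finite_induct) (simp_all add: matrix_vector_mult_add_rdistrib)

lemma span_columns_eq_range:
  fixes M :: "real ^ 'l ^ 'k"
  shows "span (columns M) = range ((*v) M)"
proof (rule antisym)
  have "subspace (range ((*v) M))"
    by (intro linear_subspace_image matrix_vector_mul_linear subspace_UNIV)
  moreover have "columns M \<subseteq> range ((*v) M)"
    by (auto simp: columns_def simp flip: matrix_vector_mult_basis)
  ultimately show "span (columns M) \<subseteq> range ((*v) M)"
    by (intro span_minimal)
  show "range ((*v) M) \<subseteq> span (columns M)"
    using matrix_vector_mult_in_columnspace by blast
qed

text \<open>The subspaces in \<open>A0\<close> are those spanned by the singular vectors.\<close>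

lemma compact_svd_span_columns:
  assumes svd: "compact_svd M q s u v"
  shows "span (columns M) = span (u ` {..<q})"
proof -
  have M: "M = (\<Sum>i<q. s i *\<^sub>R outer (u i) (v i))"
    and s: "\<And>i. i < q \<Longrightarrow> 0 < s i"
    and v: "\<And>i j. i < q \<Longrightarrow> j < q \<Longrightarrow> v i \<bullet> v j = (if i = j then 1 else 0)"
    using svd unfolding compact_svd_def by blast+
  have Mx: "M *v x = (\<Sum>i<q. (s i * (v i \<bullet> x)) *\<^sub>R u i)" for x
    by (subst M)
      (simp add: sum_matrix_vector_mult outer_mult_vec flip: scaleR_matrix_vector_assoc)
  have "M *v x \<in> span (u ` {..<q})" for x
    unfolding Mx by (intro span_sum span_scale span_base) auto
  moreover have "u j \<in> range ((*v) M)" if "j < q" for j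
  proof -
    have "M *v v j = (\<Sum>i<q. if i = j then s j *\<^sub>R u j else 0)"
      unfolding Mx using v that by (intro sum.cong) auto
    also have "\<dots> = s j *\<^sub>R u j"
      using that by simp
    finally have "M *v ((1 / s j) *\<^sub>R v j) = u j"
      using s[OF that] by (simp add: matrix_vector_mult_scaleR)
    then show ?thesis by (metis rangeI)
  qed
  ultimately have "range ((*v) M) \<subseteq> span (u ` {..<q})" "u ` {..<q} \<subseteq> range ((*v) M)"
    by blast+
  then show ?thesis
    unfolding span_columns_eq_range[symmetric]
    by (metis antisym span_mono span_span)
qed

lemma compact_svd_transpose:
  assumes svd: "compact_svd M q s u v"
  shows "compact_svd (transpose M) q s v u"
proof -
  have M: "M = (\<Sum>i<q. s i *\<^sub>R outer (u i) (v i))"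
    using svd unfolding compact_svd_def by blast
  have "transpose M = (\<Sum>i<q. s i *\<^sub>R outer (v i) (u i))"
    by (subst M) (simp add: vec_eq_iff transpose_def outer_def mult_ac)
  then show ?thesis
    using svd unfolding compact_svd_def rank_transpose by blast
qed

lemma compact_svd_span_rows:
  assumes "compact_svd M q s u v"
  shows "span (rows M) = span (v ` {..<q})"
  using compact_svd_span_columns[OF compact_svd_transpose[OF assms]] by simp

end

theory Submission
  imports Defs
begin

text \<open>
  With feature vectors \<open>v\<^sub>i = (1, p\<^sub>i, \<bar>p\<^sub>i\<bar>\<^sup>2)\<close>, the distance matrix factors as \<open>\<Delta> = X S X\<^sup>T\<close>, where
  \<open>X\<close> has the rows \<open>v\<^sub>i\<close>. So the column space of \<open>\<Delta>\<close> lies in that of \<open>X\<close>, and if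
  \<open>X\<^sup>T X \<ge> \<tau>\<close> then \<open>\<bar>P\<^sub>U e\<^sub>i\<bar>\<^sup>2 \<le> \<bar>v\<^sub>i\<bar>\<^sup>2 / \<tau>\<close>, which gives both \<open>A0\<close> and \<open>A1\<close>. The eigenvalues of
  \<open>E (v\<^sub>i v\<^sub>i\<^sup>T)\<close> are \<open>m\<^sub>2\<close> and the three roots of the cubic, so a matrix Chernoff bound for
  \<open>X\<^sup>T X = \<Sum>i. v\<^sub>i v\<^sub>i\<^sup>T\<close> yields \<open>\<tau> = t N \<lambda>\<^sup>*\<close> with the stated probability. The Chernoff bound is
  obtained without matrix exponentials, by controlling \<open>E (tr (1 - (s / n) X\<^sup>T X) ^ n)\<close> for
  finite \<open>n\<close> and letting \<open>n\<close> tend to infinity.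

  \<open>A0\<close> and \<open>A1\<close> depend discontinuously on the matrix. Their event is measurable because both
  can be read off the entries of the polar factor \<open>\<Sum>i. u\<^sub>i v\<^sub>i\<^sup>T\<close>, a pointwise limit of
  Newton-Schulz iterates, which are polynomial in the matrix entries.
\<close>

section \<open>Rank one perturbations and traces of powers\<close>

text \<open>The usual route to a matrix Chernoff bound separates the exponential of a sum by
  Golden-Thompson or Lieb. Here the trace of an odd power \<open>2 * k + 1\<close> is differentiated
  along \<open>K = H - u v v^T\<close>; up to the factor \<open>- (2 * k + 1)\<close> the derivative
  is the quadratic form of the even power \<open>K ^ (2 * k)\<close> at \<open>v\<close>. At
  \<open>u = 0\<close> this form is the sum of the squares of \<open>v \<bullet> (H ^ k) b\<close>
  over basis vectors \<open>b\<close>, which is where independence of \<open>v\<close> and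
  \<open>H\<close> can enter.

  The second-moment matrix of the features splits in two. On vectors \<open>(0, y, 0)\<close> whose
  \<open>y\<close> has coordinate sum 0 it is \<open>m 2\<close> times the identity. On the span of
  \<open>(1, 0, 0)\<close>, \<open>(0, ones, 0)\<close> and \<open>(0, 0, 1)\<close> it is the 3 x 3
  matrix behind the cubic. Atomlessness makes 1, s, s^2 linearly independent in L^2(P), so this
  matrix is nonsingular.

  Constants: \<open>R = 1 + d c^2 + d^2 c^4\<close> bounds the squared length of a feature, so
  \<open>\<theta> = R / lam_star\<close>. The factor \<open>d + 2\<close> in the tail bound is the
  trace of the identity on the feature space. \<open>(1 - t)^2 / 2\<close> is a lower bound for the
  Chernoff exponent \<open>t ln t + 1 - t\<close>.\<close>

definition rank_one_minus :: "('a::euclidean_space \<Rightarrow> 'a) \<Rightarrow> real \<Rightarrow> 'a \<Rightarrow> 'a \<Rightarrow> 'a" where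
  "rank_one_minus H e v = (\<lambda>x. H x - (e * (v \<bullet> x)) *\<^sub>R v)"

text \<open>Operators are plain functions, so powers are iterates \<open>^^\<close> and the space
  may be any euclidean space, in particular the product type that holds the features.\<close>

definition trace_op :: "('a::euclidean_space \<Rightarrow> 'a) \<Rightarrow> real" where
  "trace_op T = (\<Sum>b\<in>Basis. b \<bullet> T b)"

text \<open>The ratios \<open>a (Suc j) / a j\<close> are nondecreasing. Hence
  \<open>a j / a 0\<close>, the product of the first \<open>j\<close> ratios, is at most the product
  of the \<open>j\<close> ratios starting at \<open>l\<close>, which is
  \<open>a (j + l) / a l\<close>.\<close>

lemma log_convex_mult_le:
  fixes a :: "nat \<Rightarrow> real"
  assumes pos: "\<And>j. 0 < a j" and lc: "\<And>j. (a (Suc j))\<^sup>2 \<le> a j * a (j + 2)"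
  shows "a j * a l \<le> a 0 * a (j + l)"
proof -
  define r where "r j = a (Suc j) / a j" for j
  have "r j \<le> r (Suc j)" for j
    using lc[of j] pos[of j] pos[of "Suc j"]
    by (simp add: r_def field_simps power2_eq_square)
  then have mono: "r i \<le> r k" if "i \<le> k" for i k
    using that by (metis lift_Suc_mono_le)
  have a_Suc: "a (Suc j) = r j * a j" for j
    using pos[of j] by (simp add: r_def)
  have r_pos: "0 < r j" for j
    using pos by (simp add: r_def)
  show ?thesis
  proof (induction j)
    case (Suc j)
    have "a (Suc j) * a l = r j * (a j * a l)"
      by (simp add: a_Suc)
    also have "\<dots> \<le> r j * (a 0 * a (j + l))"
      using Suc r_pos[of j] by (intro mult_left_mono) auto
    also have "\<dots> \<le> r (j + l) * (a 0 * a (j + l))"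
      using pos[of 0] pos[of "j + l"] by (intro mult_right_mono mono) auto
    also have "\<dots> = a 0 * a (Suc j + l)"
      by (simp add: a_Suc)
    finally show ?case .
  qed simp
qed

text \<open>The strict bound \<delta> makes all moments \<open>x \<bullet> (K ^^ n) x\<close> of a
  nonzero \<open>x\<close> positive, as log-convexity requires, and lets an odd power be compared
  with the even power below it.\<close>

locale sym_pos_op =
  fixes K :: "'a::euclidean_space \<Rightarrow> 'a" and \<delta> :: real
  assumes lin: "linear K" and sym: "x \<bullet> K y = K x \<bullet> y"
    and \<delta>: "0 < \<delta>" and lower: "\<delta> * (x \<bullet> x) \<le> x \<bullet> K x"
begin

lemma inner_funpow: "x \<bullet> (K ^^ n) y = (K ^^ n) x \<bullet> y"
  by (induction n arbitrary: x y) (simp_all add: sym funpow_swap1)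

lemma inner_funpow_add: "(K ^^ i) x \<bullet> (K ^^ j) y = x \<bullet> (K ^^ (i + j)) y"
  by (simp add: funpow_add inner_funpow)

lemma inner_nonneg: "0 \<le> x \<bullet> K x"
  using lower[of x] \<delta> by (meson inner_ge_zero mult_nonneg_nonneg order_trans less_imp_le)

lemma inner_pos: "x \<noteq> 0 \<Longrightarrow> 0 < x \<bullet> K x"
  using lower[of x] \<delta> by (metis inner_gt_zero_iff mult_pos_pos order_less_le_trans)

lemma Cauchy_Schwarz_op: "(x \<bullet> K y)\<^sup>2 \<le> (x \<bullet> K x) * (y \<bullet> K y)"
proof (cases "y = 0")
  case True
  then show ?thesis by (simp add: linear_0[OF lin])
next
  case False
  define s where "s = (x \<bullet> K y) / (y \<bullet> K y)"
  have yp: "0 < y \<bullet> K y" using inner_pos[OF False] .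
  have yx: "y \<bullet> K x = x \<bullet> K y" by (metis sym inner_commute)
  have "0 \<le> (x - s *\<^sub>R y) \<bullet> K (x - s *\<^sub>R y)" by (rule inner_nonneg)
  also have "\<dots> = x \<bullet> K x - 2 * s * (x \<bullet> K y) + s\<^sup>2 * (y \<bullet> K y)"
    by (simp add: linear_diff[OF lin] linear_scale[OF lin] inner_diff_left inner_diff_right yx
        power2_eq_square algebra_simps)
  also have "\<dots> = x \<bullet> K x - (x \<bullet> K y)\<^sup>2 / (y \<bullet> K y)"
    using yp by (simp add: s_def field_simps power2_eq_square)
  finally show ?thesis
    using yp by (simp add: field_simps)
qed

lemma funpow_nonzero: "x \<noteq> 0 \<Longrightarrow> (K ^^ n) x \<noteq> 0"
proof (induction n)
  case (Suc n)
  then show ?case using inner_pos[of "(K ^^ n) x"] by auto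
qed simp

text \<open>Half of the power moves to the other side by symmetry; an odd power leaves one
  \<open>K\<close> in the middle. Positivity of every power then follows without a square root of
  \<open>K\<close>.\<close>

lemma parity_cases_funpow:
  "x \<bullet> (K ^^ (2 * m)) x = (norm ((K ^^ m) x))\<^sup>2"
  "x \<bullet> (K ^^ (Suc (2 * m))) x = (K ^^ m) x \<bullet> K ((K ^^ m) x)"
proof -
  show "x \<bullet> (K ^^ (2 * m)) x = (norm ((K ^^ m) x))\<^sup>2"
    by (simp add: power2_norm_eq_inner inner_funpow_add mult_2)
  have "(K ^^ m) x \<bullet> (K ^^ Suc m) x = x \<bullet> (K ^^ (m + Suc m)) x"
    by (rule inner_funpow_add)
  then show "x \<bullet> (K ^^ (Suc (2 * m))) x = (K ^^ m) x \<bullet> K ((K ^^ m) x)"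
    by (simp add: mult_2)
qed

lemma inner_funpow_pos: "x \<noteq> 0 \<Longrightarrow> 0 < x \<bullet> (K ^^ n) x"
proof (cases "even n")
  case True
  then obtain m where "n = 2 * m" by blast
  moreover assume "x \<noteq> 0"
  ultimately show ?thesis by (simp add: parity_cases_funpow funpow_nonzero)
next
  case False
  then obtain m where "n = Suc (2 * m)" by (auto elim: oddE)
  moreover assume "x \<noteq> 0"
  ultimately show ?thesis
    by (metis funpow_nonzero inner_pos parity_cases_funpow(2))
qed

text \<open>Cauchy-Schwarz for \<open>(K ^^ m) x\<close> and \<open>(K ^^ Suc m) x\<close>: in the
  ordinary inner product when \<open>n = 2 * m\<close>, and in the form given by \<open>K\<close>
  when \<open>n = Suc (2 * m)\<close>.\<close>

lemma inner_funpow_log_convex: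
  "(x \<bullet> (K ^^ Suc n) x)\<^sup>2 \<le> (x \<bullet> (K ^^ n) x) * (x \<bullet> (K ^^ (n + 2)) x)"
proof (cases "even n")
  case True
  then obtain m where n: "n = 2 * m" by blast
  have "n + 2 = 2 * Suc m" using n by simp
  then have e: "x \<bullet> (K ^^ n) x = (norm ((K ^^ m) x))\<^sup>2"
    "x \<bullet> (K ^^ (n + 2)) x = (norm ((K ^^ Suc m) x))\<^sup>2"
    "x \<bullet> (K ^^ Suc n) x = (K ^^ m) x \<bullet> (K ^^ Suc m) x"
    unfolding n by (simp_all only: parity_cases_funpow) simp
  show ?thesis
    unfolding e power2_norm_eq_inner by (rule Cauchy_Schwarz_ineq)
next
  case False
  then obtain m where n: "n = Suc (2 * m)" by (auto elim: oddE)
  have n2: "n + 2 = Suc (2 * Suc m)" "Suc n = m + Suc (Suc m)" using n by simp_all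
  have e: "x \<bullet> (K ^^ n) x = (K ^^ m) x \<bullet> K ((K ^^ m) x)"
    "x \<bullet> (K ^^ (n + 2)) x = (K ^^ Suc m) x \<bullet> K ((K ^^ Suc m) x)"
    unfolding n2 unfolding n by (simp_all only: parity_cases_funpow)
  have "x \<bullet> (K ^^ Suc n) x = (K ^^ m) x \<bullet> K ((K ^^ Suc m) x)"
    unfolding n2 by (subst inner_funpow_add[symmetric]) simp
  then show ?thesis
    unfolding e using Cauchy_Schwarz_op by simp
qed

lemma inner_funpow_mult_le:
  "(x \<bullet> (K ^^ i) x) * (x \<bullet> (K ^^ j) x) \<le> (x \<bullet> x) * (x \<bullet> (K ^^ (i + j)) x)"
proof (cases "x = 0")
  case False
  show ?thesis
    using log_convex_mult_le[of "\<lambda>n. x \<bullet> (K ^^ n) x" i j, OF inner_funpow_pos[OF False]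
        inner_funpow_log_convex] by simp
qed simp

text \<open>Jensen's inequality for the spectral measure of \<open>K\<close> at \<open>x\<close>,
  obtained without diagonalisation by splitting off one factor at a time.\<close>

lemma power_le_inner_funpow:
  assumes "norm x = 1"
  shows "(x \<bullet> K x) ^ n \<le> x \<bullet> (K ^^ n) x"
proof (induction n)
  case (Suc n)
  have "(x \<bullet> K x) ^ Suc n \<le> (x \<bullet> K x) * (x \<bullet> (K ^^ n) x)"
    using Suc inner_nonneg[of x] by (simp add: mult_left_mono)
  also have "\<dots> \<le> x \<bullet> (K ^^ Suc n) x"
    using inner_funpow_mult_le[of x 1 n] assms by (simp flip: power2_norm_eq_inner)
  finally show ?case .
qed (use assms in \<open>simp flip: power2_norm_eq_inner\<close>)

lemma trace_op_even: "trace_op (K ^^ (2 * m)) = (\<Sum>b\<in>Basis. (norm ((K ^^ m) b))\<^sup>2)"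
  by (simp only: trace_op_def parity_cases_funpow)

lemma trace_op_odd:
  "trace_op (K ^^ (Suc (2 * m))) = (\<Sum>b\<in>Basis. (K ^^ m) b \<bullet> K ((K ^^ m) b))"
  by (simp only: trace_op_def parity_cases_funpow)

lemma trace_op_odd_ge: "\<delta> * trace_op (K ^^ (2 * m)) \<le> trace_op (K ^^ (Suc (2 * m)))"
  unfolding trace_op_even trace_op_odd sum_distrib_left power2_norm_eq_inner
  by (intro sum_mono lower)

lemma trace_op_odd_nonneg: "0 \<le> trace_op (K ^^ (Suc (2 * m)))"
  unfolding trace_op_odd by (intro sum_nonneg inner_nonneg)

lemma sum_inner_funpow_sq: "(\<Sum>b\<in>Basis. (x \<bullet> (K ^^ m) b)\<^sup>2) = (norm ((K ^^ m) x))\<^sup>2"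
proof -
  have "(\<Sum>b\<in>Basis. (x \<bullet> (K ^^ m) b)\<^sup>2) = (\<Sum>b\<in>Basis. ((K ^^ m) x \<bullet> b) * ((K ^^ m) x \<bullet> b))"
    by (simp add: inner_funpow[symmetric] power2_eq_square)
  then show ?thesis by (simp only: euclidean_inner[symmetric] power2_norm_eq_inner)
qed

text \<open>Stands in for the fact that the trace dominates the largest eigenvalue: Jensen, then
  Parseval for \<open>(K ^^ m) x\<close>, then Cauchy-Schwarz for each basis vector.\<close>

lemma power_le_trace_op:
  assumes "norm x = 1"
  shows "(x \<bullet> K x) ^ (2 * m) \<le> trace_op (K ^^ (2 * m))"
proof -
  have "(x \<bullet> K x) ^ (2 * m) \<le> (norm ((K ^^ m) x))\<^sup>2"
    using power_le_inner_funpow[OF assms, of "2 * m"] by (simp only: parity_cases_funpow)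
  also have "\<dots> = (\<Sum>b\<in>Basis. (x \<bullet> (K ^^ m) b)\<^sup>2)"
    by (simp add: sum_inner_funpow_sq)
  also have "\<dots> \<le> (\<Sum>b\<in>Basis. (norm ((K ^^ m) b))\<^sup>2)"
  proof (intro sum_mono)
    fix b :: 'a
    have "\<bar>x \<bullet> (K ^^ m) b\<bar> \<le> norm ((K ^^ m) b)"
      using Cauchy_Schwarz_ineq2[of x "(K ^^ m) b"] assms by simp
    then show "(x \<bullet> (K ^^ m) b)\<^sup>2 \<le> (norm ((K ^^ m) b))\<^sup>2"
      by (simp add: abs_le_square_iff[symmetric])
  qed
  finally show ?thesis by (simp only: trace_op_even)
qed

end

section \<open>Differentiation along a rank one perturbation\<close>

lemma linear_rank_one_minus: "linear H \<Longrightarrow> linear (rank_one_minus H e v)"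
  by (rule linearI)
    (simp_all add: rank_one_minus_def linear_add linear_scale inner_add_right algebra_simps)

text \<open>The product rule: one of the \<open>j\<close> factors is replaced by its derivative
  \<open>- v v^T\<close>, with \<open>i\<close> factors acting before it and
  \<open>j - 1 - i\<close> after it.\<close>

lemma has_vector_derivative_funpow_rank_one_minus:
  fixes v :: "'a::euclidean_space"
  assumes lin: "linear H"
  defines "K \<equiv> \<lambda>e. rank_one_minus H e v"
  shows "((\<lambda>e. (K e ^^ j) x) has_vector_derivative
     - (\<Sum>i<j. (v \<bullet> (K e ^^ i) x) *\<^sub>R (K e ^^ (j - 1 - i)) v)) (at e)"
proof (induction j)
  case 0
  then show ?case by simp
next
  case (Suc j)
  let ?y = "\<lambda>e. (K e ^^ j) x"
  let ?d = "- (\<Sum>i<j. (v \<bullet> (K e ^^ i) x) *\<^sub>R (K e ^^ (j - 1 - i)) v)"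
  have bl: "bounded_linear H" using lin by (simp add: linear_conv_bounded_linear)
  have K_app: "K e y = H y - (e * (v \<bullet> y)) *\<^sub>R v" for e y
    by (simp add: K_def rank_one_minus_def)
  have lK: "linear (K e)" unfolding K_def by (rule linear_rank_one_minus[OF lin])
  have K_Suc: "K e ((K e ^^ (j - Suc i)) v) = (K e ^^ (j - i)) v" if "i < j" for i
  proof -
    have "j - i = Suc (j - Suc i)" using that by simp
    then show ?thesis by simp
  qed
  have d1: "((\<lambda>e. v \<bullet> ?y e) has_real_derivative (v \<bullet> ?d)) (at e)"
    using bounded_linear.has_vector_derivative[OF bounded_linear_inner_right Suc]
    by (simp add: has_real_derivative_iff_has_vector_derivative)
  have "((\<lambda>e. H (?y e) - (e * (v \<bullet> ?y e)) *\<^sub>R v) has_vector_derivative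
      H ?d - (1 * (v \<bullet> ?y e) + (v \<bullet> ?d) * e) *\<^sub>R v) (at e)"
  proof (intro has_vector_derivative_diff bounded_linear.has_vector_derivative[OF bl Suc])
    have "((\<lambda>e. e * (v \<bullet> ?y e)) has_real_derivative (1 * (v \<bullet> ?y e) + (v \<bullet> ?d) * e)) (at e)"
      by (intro DERIV_mult DERIV_ident d1)
    then show "((\<lambda>e. (e * (v \<bullet> ?y e)) *\<^sub>R v) has_vector_derivative
        (1 * (v \<bullet> ?y e) + (v \<bullet> ?d) * e) *\<^sub>R v) (at e)"
      using bounded_linear.has_vector_derivative[OF bounded_linear_scaleR_left]
      by (simp add: has_real_derivative_iff_has_vector_derivative)
  qed
  moreover have "H ?d - (1 * (v \<bullet> ?y e) + (v \<bullet> ?d) * e) *\<^sub>R v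
      = K e ?d - (v \<bullet> ?y e) *\<^sub>R v"
    by (simp add: K_app algebra_simps)
  moreover have "K e ?d = - (\<Sum>i<j. (v \<bullet> (K e ^^ i) x) *\<^sub>R (K e ^^ (j - i)) v)"
    by (simp add: linear_neg[OF lK] linear_sum[OF lK] linear_scale[OF lK] K_Suc)
  then have "- (\<Sum>i<Suc j. (v \<bullet> (K e ^^ i) x) *\<^sub>R (K e ^^ (Suc j - 1 - i)) v)
      = K e ?d - (v \<bullet> ?y e) *\<^sub>R v"
    by simp
  moreover have "(\<lambda>e. (K e ^^ Suc j) x) = (\<lambda>e. H (?y e) - (e * (v \<bullet> ?y e)) *\<^sub>R v)"
    by (simp add: fun_eq_iff K_app)
  ultimately show ?case
    by (simp only:)
qed


text \<open>Lowering \<open>e\<close> adds a nonnegative multiple of \<open>v v^T\<close>, so the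
  bound \<delta> at the end of the path holds along the whole path.\<close>

lemma sym_pos_op_rank_one_minus:
  assumes "sym_pos_op (rank_one_minus H e v) \<delta>" "e' \<le> e"
  shows "sym_pos_op (rank_one_minus H e' v) \<delta>"
proof -
  interpret K: sym_pos_op "rank_one_minus H e v" \<delta> by fact
  have eq: "rank_one_minus H e' v x = rank_one_minus H e v x + ((e - e') * (v \<bullet> x)) *\<^sub>R v" for x
    by (simp add: rank_one_minus_def algebra_simps)
  show ?thesis
  proof (rule sym_pos_op.intro)
    show "linear (rank_one_minus H e' v)"
      by (rule linearI) (simp_all add: eq linear_add[OF K.lin] linear_scale[OF K.lin]
          inner_add_right algebra_simps)
    show "x \<bullet> rank_one_minus H e' v y = rank_one_minus H e' v x \<bullet> y" for x y
      by (simp add: eq inner_add_left inner_add_right K.sym[of x y] inner_commute[of v x] mult_ac)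
    show "0 < \<delta>" by (rule K.\<delta>)
    show "\<delta> * (x \<bullet> x) \<le> x \<bullet> rank_one_minus H e' v x" for x
    proof -
      have "0 \<le> (e - e') * (v \<bullet> x)\<^sup>2" using assms(2) by simp
      then show ?thesis
        using K.lower[of x] by (simp add: eq inner_add_right power2_eq_square inner_commute mult_ac)
    qed
  qed
qed

text \<open>A Golden-Thompson inequality for rank one perturbations, in polynomial form: for
  \<open>H = 1 - (s / n) A\<close> and \<open>n \<rightarrow> \<infinity>\<close> the traces become those of \<open>exp (- s (A + v v\<^sup>T))\<close> and
  \<open>exp (- s A)\<close>. Along the perturbation the trace decreases at the rate \<open>n g\<close> with
  \<open>g = v \<bullet> K ^ (2 k) v\<close>, and \<open>g' \<ge> - \<beta> g\<close> by log-convexity of \<open>j \<mapsto> v \<bullet> K ^ j v\<close>.\<close>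

lemma trace_op_rank_one_minus_le:
  fixes v :: "'a::euclidean_space"
  assumes K: "sym_pos_op (rank_one_minus H e v) \<delta>"
    and e: "0 \<le> e" and R: "0 < R" and vR: "v \<bullet> v \<le> R"
  shows "trace_op (rank_one_minus H e v ^^ Suc (2 * k)) \<le> trace_op (H ^^ Suc (2 * k))
    - \<delta> / R * (1 - exp (- (real (Suc (2 * k)) * R / \<delta>) * e)) * (v \<bullet> (H ^^ (2 * k)) v)"
proof -
  define n where "n = Suc (2 * k)"
  define \<beta> where "\<beta> = real n * R / \<delta>"
  define T where "T u = rank_one_minus H u v" for u
  define \<phi> where "\<phi> j u = v \<bullet> (T u ^^ j) v" for j u
  have K': "sym_pos_op (T u) \<delta>" if "u \<le> e" for u
    unfolding T_def using sym_pos_op_rank_one_minus[OF K that] .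
  have T0: "T 0 = H" by (simp add: T_def rank_one_minus_def fun_eq_iff)
  have lin: "linear H" using K'[of 0] e T0 by (simp add: sym_pos_op_def)
  have \<delta>: "0 < \<delta>" using K by (simp add: sym_pos_op_def)
  have \<beta>: "0 < \<beta>" using \<delta> R by (simp add: \<beta>_def n_def)
  have der: "((\<lambda>u. (T u ^^ j) x) has_vector_derivative
     - (\<Sum>i<j. (v \<bullet> (T u ^^ i) x) *\<^sub>R (T u ^^ (j - 1 - i)) v)) (at u)" for j x u
    unfolding T_def by (rule has_vector_derivative_funpow_rank_one_minus[OF lin])
  have der_inner: "((\<lambda>u. y \<bullet> (T u ^^ j) x) has_real_derivative
     - (\<Sum>i<j. (v \<bullet> (T u ^^ i) x) * (y \<bullet> (T u ^^ (j - 1 - i)) v))) (at u)" for j x y u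
    using bounded_linear.has_vector_derivative[OF bounded_linear_inner_right der, of y]
    by (simp add: has_real_derivative_iff_has_vector_derivative inner_sum_right)
  have \<phi>_nonneg: "0 \<le> \<phi> (2 * k) u" if "u \<le> e" for u
    unfolding \<phi>_def by (subst sym_pos_op.parity_cases_funpow[OF K'[OF that]]) simp
  \<comment> \<open>Log-convexity is applied twice, first to reach
    \<open>(v \<bullet> v) * \<phi> (2 * k - 1) u\<close> and then to raise the order to
    \<open>2 * k\<close>. In between, \<open>\<delta> * (v \<bullet> v) \<le> \<phi> 1 u\<close>
    supplies the missing power, at the cost of the factor \<open>1 / \<delta>\<close>.\<close>
  have \<phi>_bound: "\<phi> i u * \<phi> (2 * k - 1 - i) u \<le> R / \<delta> * \<phi> (2 * k) u"
    if u: "u \<le> e" and i: "i < 2 * k" for i u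
  proof -
    interpret K: sym_pos_op "T u" \<delta> by (rule K'[OF u])
    have nn: "0 \<le> \<phi> (2 * k - 1) u"
      using K.inner_funpow_pos[of v "2 * k - 1"] unfolding \<phi>_def by (cases "v = 0") auto
    have "\<phi> i u * \<phi> (2 * k - 1 - i) u \<le> (v \<bullet> v) * \<phi> (2 * k - 1) u"
      using K.inner_funpow_mult_le[of v i "2 * k - 1 - i"] i unfolding \<phi>_def by simp
    then have "\<delta> * (\<phi> i u * \<phi> (2 * k - 1 - i) u) \<le> (\<delta> * (v \<bullet> v)) * \<phi> (2 * k - 1) u"
      using \<delta> by (simp add: mult.assoc)
    also have "\<dots> \<le> \<phi> 1 u * \<phi> (2 * k - 1) u"
      using K.lower[of v] nn by (intro mult_right_mono) (simp_all add: \<phi>_def)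
    also have "\<dots> \<le> (v \<bullet> v) * \<phi> (2 * k) u"
      using K.inner_funpow_mult_le[of v 1 "2 * k - 1"] i unfolding \<phi>_def by simp
    also have "\<dots> \<le> R * \<phi> (2 * k) u"
      using vR \<phi>_nonneg[OF u] by (intro mult_right_mono)
    finally show ?thesis using \<delta> by (simp add: field_simps)
  qed
  have g_der: "\<exists>D. (\<phi> (2 * k) has_real_derivative D) (at u) \<and> - \<beta> * \<phi> (2 * k) u \<le> D"
    if u: "u \<le> e" for u
  proof (intro exI conjI)
    show "(\<phi> (2 * k) has_real_derivative
      - (\<Sum>i<2 * k. \<phi> i u * \<phi> (2 * k - 1 - i) u)) (at u)"
      using der_inner unfolding \<phi>_def .
    have "(\<Sum>i<2 * k. \<phi> i u * \<phi> (2 * k - 1 - i) u) \<le> (\<Sum>i<2 * k. R / \<delta> * \<phi> (2 * k) u)"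
      using \<phi>_bound[OF u] by (intro sum_mono) auto
    also have "\<dots> \<le> \<beta> * \<phi> (2 * k) u"
      using \<phi>_nonneg[OF u] \<delta> R by (simp add: \<beta>_def n_def field_simps)
    finally show "- \<beta> * \<phi> (2 * k) u \<le> - (\<Sum>i<2 * k. \<phi> i u * \<phi> (2 * k - 1 - i) u)"
      by simp
  qed
  have g_lower: "exp (- \<beta> * u) * \<phi> (2 * k) 0 \<le> \<phi> (2 * k) u" if u: "0 \<le> u" "u \<le> e" for u
  proof -
    \<comment> \<open>The integrating factor turns the differential inequality for
      \<open>\<phi> (2 * k)\<close> into monotonicity.\<close>
    have "exp (\<beta> * 0) * \<phi> (2 * k) 0 \<le> exp (\<beta> * u) * \<phi> (2 * k) u"
    proof (rule DERIV_nonneg_imp_nondecreasing[OF u(1)])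
      fix w assume w: "0 \<le> w" "w \<le> u"
      then obtain D where D: "(\<phi> (2 * k) has_real_derivative D) (at w)"
        "- \<beta> * \<phi> (2 * k) w \<le> D"
        using g_der[of w] u by auto
      have "((\<lambda>u. exp (\<beta> * u)) has_real_derivative exp (\<beta> * w) * \<beta>) (at w)"
        by (auto intro!: derivative_eq_intros)
      from DERIV_mult[OF this D(1)]
      have "((\<lambda>u. exp (\<beta> * u) * \<phi> (2 * k) u) has_real_derivative
          exp (\<beta> * w) * \<beta> * \<phi> (2 * k) w + D * exp (\<beta> * w)) (at w)" .
      moreover have "exp (\<beta> * w) * \<beta> * \<phi> (2 * k) w + D * exp (\<beta> * w)
          = exp (\<beta> * w) * (\<beta> * \<phi> (2 * k) w + D)"
        by (simp add: algebra_simps)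
      moreover have "0 \<le> exp (\<beta> * w) * (\<beta> * \<phi> (2 * k) w + D)"
        using D(2) by simp
      ultimately show "\<exists>y. ((\<lambda>u. exp (\<beta> * u) * \<phi> (2 * k) u) has_real_derivative y) (at w) \<and> 0 \<le> y"
        by metis
    qed
    then show ?thesis by (simp add: exp_minus field_simps)
  qed
  define f where "f u = trace_op (T u ^^ n)" for u
  have f_der: "(f has_real_derivative - real n * \<phi> (2 * k) u) (at u)" if "u \<le> e" for u
  proof -
    interpret K: sym_pos_op "T u" \<delta> by (rule K'[OF that])
    have r: "(v \<bullet> (T u ^^ i) b) * (b \<bullet> (T u ^^ j) v) = ((T u ^^ i) v \<bullet> b) * ((T u ^^ j) v \<bullet> b)" for i j b
      by (simp only: K.inner_funpow[of v] inner_commute[of b])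
    \<comment> \<open>After Parseval in the basis, all \<open>n\<close> terms of the product rule
      agree: each is \<open>v \<bullet> (T u ^^ (n - 1)) v\<close>, and
      \<open>n - 1 = 2 * k\<close>.\<close>
    have "(f has_real_derivative
      (\<Sum>b\<in>Basis. - (\<Sum>i<n. (v \<bullet> (T u ^^ i) b) * (b \<bullet> (T u ^^ (n - 1 - i)) v)))) (at u)"
      unfolding f_def trace_op_def by (intro DERIV_sum der_inner)
    also have "(\<Sum>b\<in>Basis. - (\<Sum>i<n. (v \<bullet> (T u ^^ i) b) * (b \<bullet> (T u ^^ (n - 1 - i)) v)))
      = - (\<Sum>i<n. \<Sum>b\<in>Basis. ((T u ^^ i) v \<bullet> b) * ((T u ^^ (n - 1 - i)) v \<bullet> b))"
      unfolding sum_negf r by (subst sum.swap) (rule refl)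
    also have "\<dots> = - (\<Sum>i<n. (T u ^^ i) v \<bullet> (T u ^^ (n - 1 - i)) v)"
      by (simp add: euclidean_inner[symmetric])
    also have "\<dots> = - (\<Sum>i<n. \<phi> (2 * k) u)"
      by (intro arg_cong[where f = uminus] sum.cong) (auto simp: K.inner_funpow_add \<phi>_def n_def)
    finally show ?thesis by simp
  qed
  \<comment> \<open>Since \<open>\<delta> / R = n / \<beta>\<close>, the added term is the integral
    of \<open>n * exp (- \<beta> * w) * \<phi> (2 * k) 0\<close> over \<open>w\<close> from 0 to
    \<open>u\<close>, the least drop that \<open>g_lower\<close> guarantees.\<close>
  let ?F = "\<lambda>u. f u + \<delta> / R * (1 - exp (- \<beta> * u)) * \<phi> (2 * k) 0"
  have "?F e \<le> ?F 0"
  proof (rule DERIV_nonpos_imp_nonincreasing[OF e])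
    fix w assume w: "0 \<le> w" "w \<le> e"
    have "(?F has_real_derivative
      - real n * \<phi> (2 * k) w + \<delta> / R * (\<beta> * exp (- \<beta> * w)) * \<phi> (2 * k) 0) (at w)"
      by (use R in \<open>auto intro!: derivative_eq_intros f_der w\<close>)
    moreover have "\<delta> / R * \<beta> = real n"
    proof -
      have "R \<noteq> 0" "\<delta> \<noteq> 0" using R \<delta> by auto
      then show ?thesis by (simp add: \<beta>_def)
    qed
    then have "- real n * \<phi> (2 * k) w + \<delta> / R * (\<beta> * exp (- \<beta> * w)) * \<phi> (2 * k) 0
      = real n * (exp (- \<beta> * w) * \<phi> (2 * k) 0 - \<phi> (2 * k) w)"
      by (simp only: right_diff_distrib mult.assoc[symmetric])
    moreover have nonpos: "real n * (exp (- \<beta> * w) * \<phi> (2 * k) 0 - \<phi> (2 * k) w) \<le> 0"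
      using g_lower[OF w] by (simp add: mult_nonneg_nonpos)
    ultimately have "(?F has_real_derivative
        real n * (exp (- \<beta> * w) * \<phi> (2 * k) 0 - \<phi> (2 * k) w)) (at w)"
      by (simp only:)
    with nonpos show "\<exists>y. (?F has_real_derivative y) (at w) \<and> y \<le> 0"
      by blast
  qed
  moreover have "?F 0 = f 0" by simp
  ultimately have "f e \<le> f 0 - \<delta> / R * (1 - exp (- \<beta> * e)) * \<phi> (2 * k) 0"
    by linarith
  then show ?thesis
    unfolding f_def \<phi>_def T0 unfolding T_def n_def \<beta>_def .
qed

section \<open>A matrix Chernoff bound\<close>

text \<open>The index set is a parameter because the expectation bound adds the independent vectors
  one at a time.\<close>

definition gram_minus :: "real \<Rightarrow> 'i set \<Rightarrow> ('i \<Rightarrow> 'a::euclidean_space) \<Rightarrow> 'a \<Rightarrow> 'a" where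
  "gram_minus e I v = (\<lambda>x. x - e *\<^sub>R (\<Sum>i\<in>I. (v i \<bullet> x) *\<^sub>R v i))"

lemma gram_minus_insert:
  assumes "finite I" "i \<notin> I"
  shows "gram_minus e (insert i I) v = rank_one_minus (gram_minus e I v) e (v i)"
  using assms by (simp add: gram_minus_def rank_one_minus_def fun_eq_iff algebra_simps)

lemma inner_gram_minus: "x \<bullet> gram_minus e I v x = x \<bullet> x - e * (\<Sum>i\<in>I. (v i \<bullet> x)\<^sup>2)"
  by (simp add: gram_minus_def inner_diff_right inner_sum_right power2_eq_square inner_commute[of x "v _"])

lemma inner_sq_le:
  fixes x y :: "'a::real_inner"
  assumes "y \<bullet> y \<le> R"
  shows "(y \<bullet> x)\<^sup>2 \<le> R * (x \<bullet> x)"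
  using Cauchy_Schwarz_ineq[of y x] mult_right_mono[OF assms inner_ge_zero[of x]] by linarith

lemma sym_pos_op_gram_minus:
  fixes v :: "'i \<Rightarrow> 'a::euclidean_space"
  assumes v: "\<And>i. i \<in> I \<Longrightarrow> v i \<bullet> v i \<le> R" and e: "0 \<le> e"
    and \<delta>: "0 < \<delta>" "e * (real (card I) * R) \<le> 1 - \<delta>"
  shows "sym_pos_op (gram_minus e I v) \<delta>"
proof (rule sym_pos_op.intro)
  show "linear (gram_minus e I v)"
    by (rule linearI) (simp_all add: gram_minus_def inner_add_right scaleR_add_left
        sum.distrib algebra_simps scaleR_sum_right)
  show "x \<bullet> gram_minus e I v y = gram_minus e I v x \<bullet> y" for x y
    by (simp add: gram_minus_def inner_diff_left inner_diff_right inner_sum_left inner_sum_right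
        inner_commute[of x] mult.commute)
  show "\<delta> * (x \<bullet> x) \<le> x \<bullet> gram_minus e I v x" for x
  proof -
    have "(\<Sum>i\<in>I. (v i \<bullet> x)\<^sup>2) \<le> (\<Sum>i\<in>I. R * (x \<bullet> x))"
      by (intro sum_mono inner_sq_le v)
    then have "e * (\<Sum>i\<in>I. (v i \<bullet> x)\<^sup>2) \<le> e * (real (card I) * R * (x \<bullet> x))"
      using e by (intro mult_left_mono) (simp_all add: mult.assoc)
    also have "\<dots> = e * (real (card I) * R) * (x \<bullet> x)" by simp
    also have "\<dots> \<le> (1 - \<delta>) * (x \<bullet> x)"
      using \<delta>(2) by (intro mult_right_mono) auto
    finally show ?thesis by (simp add: inner_gram_minus left_diff_distrib)
  qed
qed (rule \<delta>)

lemma inner_gram_minus_le: "0 \<le> e \<Longrightarrow> x \<bullet> gram_minus e I v x \<le> x \<bullet> x"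
  by (simp add: inner_gram_minus sum_nonneg)

text \<open>A crude bound, used only to make random powers almost surely bounded and hence
  integrable.\<close>

lemma norm_gram_minus_le:
  assumes v: "\<And>i. i \<in> I \<Longrightarrow> v i \<bullet> v i \<le> R" and e: "0 \<le> e" "e * (real (card I) * R) \<le> 1"
  shows "norm (gram_minus e I v x) \<le> 2 * norm x"
proof -
  have "norm ((v i \<bullet> x) *\<^sub>R v i) \<le> R * norm x" if "i \<in> I" for i
  proof -
    have "norm ((v i \<bullet> x) *\<^sub>R v i) \<le> (norm (v i) * norm x) * norm (v i)"
      unfolding norm_scaleR by (intro mult_right_mono Cauchy_Schwarz_ineq2) auto
    also have "\<dots> = (v i \<bullet> v i) * norm x"
      by (simp add: power2_norm_eq_inner[symmetric] power2_eq_square mult_ac)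
    also have "\<dots> \<le> R * norm x" by (intro mult_right_mono v that) auto
    finally show ?thesis .
  qed
  then have "norm (\<Sum>i\<in>I. (v i \<bullet> x) *\<^sub>R v i) \<le> real (card I) * (R * norm x)"
    by (rule sum_norm_bound)
  then have "norm (e *\<^sub>R (\<Sum>i\<in>I. (v i \<bullet> x) *\<^sub>R v i)) \<le> e * (real (card I) * (R * norm x))"
    using e(1) by (simp add: mult_left_mono)
  also have "\<dots> = (e * (real (card I) * R)) * norm x" by simp
  also have "\<dots> \<le> 1 * norm x" using e(2) by (intro mult_right_mono) auto
  finally show ?thesis
    unfolding gram_minus_def using norm_triangle_ineq4[of x "e *\<^sub>R (\<Sum>i\<in>I. (v i \<bullet> x) *\<^sub>R v i)"]
    by linarith
qed

lemma norm_gram_minus_funpow_le: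
  assumes v: "\<And>i. i \<in> I \<Longrightarrow> v i \<bullet> v i \<le> R" and e: "0 \<le> e" "e * (real (card I) * R) \<le> 1"
  shows "norm ((gram_minus e I v ^^ k) x) \<le> 2 ^ k * norm x"
proof (induction k)
  case (Suc k)
  have "norm ((gram_minus e I v ^^ Suc k) x) \<le> 2 * norm ((gram_minus e I v ^^ k) x)"
    using norm_gram_minus_le[OF assms] by simp
  also have "\<dots> \<le> 2 ^ Suc k * norm x" using Suc by simp
  finally show ?case .
qed simp

lemma borel_measurable_gram_minus_funpow:
  fixes v :: "'w \<Rightarrow> 'i \<Rightarrow> 'a::euclidean_space"
  assumes v: "\<And>i. i \<in> I \<Longrightarrow> (\<lambda>w. v w i) \<in> borel_measurable M"
    and x: "x \<in> borel_measurable M"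
  shows "(\<lambda>w. (gram_minus e I (v w) ^^ k) (x w)) \<in> borel_measurable M"
proof (induction k)
  case (Suc k)
  show ?case
    unfolding funpow.simps comp_def gram_minus_def[of e I "v _" ]
    by (intro borel_measurable_diff borel_measurable_scaleR borel_measurable_sum
        borel_measurable_inner borel_measurable_const v Suc[unfolded gram_minus_def])
qed (simp add: x)

text \<open>Conditioning on \<open>Z\<close> would give this at once. Instead the square is expanded
  in coordinates, so that independence is needed only for the products of the quadratic monomials of
  \<open>X\<close> and \<open>Z\<close>.\<close>

lemma (in prob_space) indep_inner_sq_ge:
  fixes X Z :: "'a \<Rightarrow> 'b::euclidean_space"
  assumes ind: "indep_var borel X borel Z"
    and X: "AE w in M. norm (X w) \<le> B" and Z: "AE w in M. norm (Z w) \<le> C"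
    and lower: "\<And>z. \<kappa> * (z \<bullet> z) \<le> expectation (\<lambda>w. (X w \<bullet> z)\<^sup>2)"
  shows "\<kappa> * expectation (\<lambda>w. Z w \<bullet> Z w) \<le> expectation (\<lambda>w. (X w \<bullet> Z w)\<^sup>2)"
proof -
  have [measurable]: "X \<in> borel_measurable M" "Z \<in> borel_measurable M"
    using ind by (auto dest: indep_var_rv1 indep_var_rv2)
  have int: "integrable M (\<lambda>w. (Y w \<bullet> a) * (Y w \<bullet> b))"
    if "AE w in M. norm (Y w) \<le> D" and [measurable]: "Y \<in> borel_measurable M" and "a \<in> Basis" "b \<in> Basis"
    for Y :: "'a \<Rightarrow> 'b" and a b D
  proof (rule integrable_const_bound[where B = "D * D"])
    show "AE w in M. norm ((Y w \<bullet> a) * (Y w \<bullet> b)) \<le> D * D"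
      using that(1)
    proof eventually_elim
      case (elim w)
      then have "\<bar>Y w \<bullet> a\<bar> \<le> D" "\<bar>Y w \<bullet> b\<bar> \<le> D"
        using Basis_le_norm[OF that(3), of "Y w"] Basis_le_norm[OF that(4), of "Y w"] by auto
      then show ?case
        unfolding real_norm_def abs_mult by (intro mult_mono) auto
    qed
  qed simp
  note intX = int[OF X] and intZ = int[OF Z]
  have ind': "indep_var borel (\<lambda>w. (X w \<bullet> a) * (X w \<bullet> b)) borel (\<lambda>w. (Z w \<bullet> a) * (Z w \<bullet> b))" for a b
    using indep_var_compose[OF ind, of "\<lambda>x. (x \<bullet> a) * (x \<bullet> b)" borel "\<lambda>x. (x \<bullet> a) * (x \<bullet> b)" borel]
    by (simp add: comp_def)
  define S where "S a b = expectation (\<lambda>w. (X w \<bullet> a) * (X w \<bullet> b))" for a b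
  have exp2: "(x \<bullet> z)\<^sup>2 = (\<Sum>a\<in>Basis. \<Sum>b\<in>Basis. ((x \<bullet> a) * (x \<bullet> b)) * ((z \<bullet> a) * (z \<bullet> b)))"
    for x z :: 'b
    by (simp add: euclidean_inner[of x z] power2_eq_square sum_product mult_ac)
  have S: "expectation (\<lambda>w. (X w \<bullet> z)\<^sup>2) = (\<Sum>a\<in>Basis. \<Sum>b\<in>Basis. S a b * ((z \<bullet> a) * (z \<bullet> b)))" for z
    unfolding exp2 S_def using intX by (simp add: Bochner_Integration.integral_sum)
  have "\<kappa> * expectation (\<lambda>w. Z w \<bullet> Z w) = expectation (\<lambda>w. \<kappa> * (Z w \<bullet> Z w))"
    by simp
  also have "\<dots> \<le> expectation (\<lambda>w. \<Sum>a\<in>Basis. \<Sum>b\<in>Basis. S a b * ((Z w \<bullet> a) * (Z w \<bullet> b)))"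
  proof (rule integral_mono)
    have "integrable M (\<lambda>w. \<Sum>a\<in>Basis. (Z w \<bullet> a) * (Z w \<bullet> a))"
      using intZ by (intro Bochner_Integration.integrable_sum) auto
    then show "integrable M (\<lambda>w. \<kappa> * (Z w \<bullet> Z w))"
      by (simp add: euclidean_inner[symmetric])
    show "integrable M (\<lambda>w. \<Sum>a\<in>Basis. \<Sum>b\<in>Basis. S a b * ((Z w \<bullet> a) * (Z w \<bullet> b)))"
      using intZ by (intro Bochner_Integration.integrable_sum integrable_mult_right) auto
  qed (use lower in \<open>simp add: S[symmetric]\<close>)
  also have "\<dots> = (\<Sum>a\<in>Basis. \<Sum>b\<in>Basis. S a b * expectation (\<lambda>w. (Z w \<bullet> a) * (Z w \<bullet> b)))"
    using intZ by (simp add: Bochner_Integration.integral_sum)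
  also have "\<dots> = (\<Sum>a\<in>Basis. \<Sum>b\<in>Basis.
      expectation (\<lambda>w. ((X w \<bullet> a) * (X w \<bullet> b)) * ((Z w \<bullet> a) * (Z w \<bullet> b))))"
    unfolding S_def using intX intZ ind'
    by (intro sum.cong refl indep_var_lebesgue_integral[symmetric]) auto
  also have "\<dots> = expectation (\<lambda>w. (X w \<bullet> Z w)\<^sup>2)"
    unfolding exp2 using indep_var_integrable[OF ind'] intX intZ
    by (simp add: Bochner_Integration.integral_sum)
  finally show ?thesis .
qed


text \<open>The two sides agree at 1, and their difference has derivative
  \<open>ln u - (u - 1) \<le> 0\<close>. This turns the exact Chernoff exponent into the quadratic
  one of the sample size condition.\<close>

lemma xlnx_ge:
  fixes t :: real
  assumes t: "0 < t" "t \<le> 1"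
  shows "(1 - t)\<^sup>2 / 2 \<le> t * ln t + 1 - t"
proof -
  let ?h = "\<lambda>t::real. t * ln t + 1 - t - (1 - t)\<^sup>2 / 2"
  have "?h 1 \<le> ?h t"
  proof (rule DERIV_nonpos_imp_nonincreasing[OF t(2)])
    fix u assume u: "t \<le> u" "u \<le> 1"
    have "(?h has_real_derivative (ln u - (u - 1))) (at u)"
      using u t by (auto intro!: derivative_eq_intros simp: field_simps)
    moreover have "ln u - (u - 1) \<le> 0" using ln_le_minus_one[of u] u t by simp
    ultimately show "\<exists>y. (?h has_real_derivative y) (at u) \<and> y \<le> 0" by blast
  qed
  then show ?thesis by simp
qed

section \<open>Expected traces and tail bounds for bounded independent vectors\<close>

locale bounded_indep_vectors = prob_space M
  for M :: "'w measure" +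
  fixes V :: "'i::finite \<Rightarrow> 'w \<Rightarrow> 'a::euclidean_space" and R \<kappa> :: real
  assumes indep: "indep_vars (\<lambda>_. borel) V UNIV"
    and bound: "\<And>i. AE w in M. V i w \<bullet> V i w \<le> R"
    and R: "0 < R"
    and \<kappa>: "0 \<le> \<kappa>"
    and second_moment: "\<And>i z. \<kappa> * (z \<bullet> z) \<le> expectation (\<lambda>w. (V i w \<bullet> z)\<^sup>2)"
begin

lemma V_measurable [measurable]: "V i \<in> borel_measurable M"
  using indep by (auto simp: indep_vars_def)

lemma AE_bound: "AE w in M. \<forall>i. V i w \<bullet> V i w \<le> R"
  using bound by (simp add: AE_all_countable)

lemma AE_norm_bound: "AE w in M. norm (V i w) \<le> sqrt R"
  using bound[of i] by eventually_elim (simp add: norm_eq_sqrt_inner)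

definition trace_pow :: "real \<Rightarrow> 'i set \<Rightarrow> nat \<Rightarrow> 'w \<Rightarrow> real" where
  "trace_pow e I n w = trace_op (gram_minus e I (\<lambda>i. V i w) ^^ n)"

lemma trace_pow_measurable [measurable]: "trace_pow e I n \<in> borel_measurable M"
  unfolding trace_pow_def trace_op_def
  by (intro borel_measurable_sum borel_measurable_inner borel_measurable_const
      borel_measurable_gram_minus_funpow) simp_all

text \<open>In the application \<open>e = s / n\<close> for a large odd \<open>n\<close>, so
  \<delta> may be taken close to 1. The smallness condition keeps every partial Gram operator at or
  above \<delta> almost surely.\<close>

context
  fixes e \<delta> :: real
  assumes e: "0 \<le> e" and \<delta>: "0 < \<delta>" and small: "e * (real CARD('i) * R) \<le> 1 - \<delta>"
begin

lemma small': "e * (real (card I) * R) \<le> 1 - \<delta>" for I :: "'i set"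
proof -
  have "card I \<le> CARD('i)" by (intro card_mono) auto
  then have "e * (real (card I) * R) \<le> e * (real CARD('i) * R)"
    using e R by (intro mult_left_mono mult_right_mono) auto
  then show ?thesis using small by linarith
qed

lemma sym_pos_op_gram:
  assumes "\<forall>i. V i w \<bullet> V i w \<le> R"
  shows "sym_pos_op (gram_minus e I (\<lambda>i. V i w)) \<delta>"
  using assms e \<delta> small' by (intro sym_pos_op_gram_minus[where R = R]) auto

lemma AE_norm_gram_funpow:
  "AE w in M. norm ((gram_minus e I (\<lambda>i. V i w) ^^ k) x) \<le> 2 ^ k * norm x"
  using AE_bound
proof eventually_elim
  case (elim w)
  have "e * (real (card I) * R) \<le> 1" using small'[of I] \<delta> by linarith
  then show ?case using elim e by (intro norm_gram_minus_funpow_le[where R = R]) auto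
qed

lemma trace_pow_integrable: "integrable M (trace_pow e I n)"
proof -
  have "integrable M (\<lambda>w. b \<bullet> (gram_minus e I (\<lambda>i. V i w) ^^ n) b)" if "b \<in> Basis" for b :: 'a
  proof (rule integrable_const_bound[where B = "2 ^ n"])
    show "AE w in M. norm (b \<bullet> (gram_minus e I (\<lambda>i. V i w) ^^ n) b) \<le> 2 ^ n"
      using AE_norm_gram_funpow[where I = I and k = n and x = b]
    proof eventually_elim
      case (elim w)
      then show ?case
        using Cauchy_Schwarz_ineq2[of b "(gram_minus e I (\<lambda>i. V i w) ^^ n) b"] that by simp
    qed
    show "(\<lambda>w. b \<bullet> (gram_minus e I (\<lambda>i. V i w) ^^ n) b) \<in> borel_measurable M"
      by (intro borel_measurable_inner borel_measurable_const borel_measurable_gram_minus_funpow) simp_all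
  qed
  then show ?thesis unfolding trace_pow_def trace_op_def by (intro Bochner_Integration.integrable_sum)
qed

text \<open>The operator lies between 0 and the identity, so inserting one more copy in the middle
  of an even power cannot increase the trace.\<close>

lemma AE_trace_pow_even_odd:
  "AE w in M. 0 \<le> trace_pow e I (Suc (2 * k)) w \<and> trace_pow e I (Suc (2 * k)) w \<le> trace_pow e I (2 * k) w"
  using AE_bound
proof eventually_elim
  case (elim w)
  interpret H: sym_pos_op "gram_minus e I (\<lambda>i. V i w)" \<delta> by (rule sym_pos_op_gram[OF elim])
  show ?case
    unfolding trace_pow_def using H.trace_op_odd_nonneg e
    by (auto simp only: H.trace_op_even H.trace_op_odd power2_norm_eq_inner
        intro!: sum_mono inner_gram_minus_le)
qed

text \<open>As \<open>i \<notin> I\<close>, the vector \<open>V i\<close> is independent of the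
  operator built from \<open>I\<close>. The even power makes the form a sum of squares of
  \<open>V i w \<bullet> ?Z b w\<close>, and \<open>indep_inner_sq_ge\<close> applies to each
  \<open>b\<close>.\<close>

lemma indep_inner_gram:
  assumes "i \<notin> I"
  shows "integrable M (\<lambda>w. V i w \<bullet> (gram_minus e I (\<lambda>i. V i w) ^^ (2 * k)) (V i w))"
    and "\<kappa> * expectation (trace_pow e I (2 * k))
    \<le> expectation (\<lambda>w. V i w \<bullet> (gram_minus e I (\<lambda>i. V i w) ^^ (2 * k)) (V i w))"
proof -
  let ?Z = "\<lambda>b w. (gram_minus e I (\<lambda>i. V i w) ^^ k) b"
  have Z [measurable]: "?Z b \<in> borel_measurable M" for b
    by (intro borel_measurable_gram_minus_funpow) simp_all
  have ind: "indep_var borel (V i) borel (?Z b)" for b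
  proof -
    have "indep_var (PiM {i} (\<lambda>_. borel)) (\<lambda>w. restrict (\<lambda>i. V i w) {i})
        (PiM I (\<lambda>_. borel)) (\<lambda>w. restrict (\<lambda>i. V i w) I)"
      using assms by (intro indep_var_restrict[OF indep]) auto
    moreover have "(\<lambda>v. v i) \<in> borel_measurable (PiM {i} (\<lambda>_. borel))"
      by simp
    moreover have "(\<lambda>v. (gram_minus e I v ^^ k) b) \<in> borel_measurable (PiM I (\<lambda>_. borel))"
      by (intro borel_measurable_gram_minus_funpow) simp_all
    ultimately have "indep_var borel ((\<lambda>v. v i) \<circ> (\<lambda>w. restrict (\<lambda>i. V i w) {i}))
        borel ((\<lambda>v. (gram_minus e I v ^^ k) b) \<circ> (\<lambda>w. restrict (\<lambda>i. V i w) I))"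
      by (rule indep_var_compose)
    moreover have "gram_minus e I (\<lambda>i\<in>I. V i w) = gram_minus e I (\<lambda>i. V i w)" for w
      by (simp add: gram_minus_def)
    ultimately show ?thesis by (simp add: comp_def)
  qed
  have Z_bound: "AE w in M. norm (?Z b w) \<le> 2 ^ k * norm b" for b
    by (rule AE_norm_gram_funpow)
  have int: "integrable M (\<lambda>w. ?Z b w \<bullet> ?Z b w)" "integrable M (\<lambda>w. (V i w \<bullet> ?Z b w)\<^sup>2)" for b
  proof -
    show "integrable M (\<lambda>w. ?Z b w \<bullet> ?Z b w)"
    proof (rule integrable_const_bound[where B = "(2 ^ k * norm b)\<^sup>2"])
      show "AE w in M. norm (?Z b w \<bullet> ?Z b w) \<le> (2 ^ k * norm b)\<^sup>2"
        using Z_bound[of b]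
      proof eventually_elim
        case (elim w)
        then show ?case by (simp only: power2_norm_eq_inner[symmetric]) (simp add: power_mono)
      qed
    qed simp
    show "integrable M (\<lambda>w. (V i w \<bullet> ?Z b w)\<^sup>2)"
    proof (rule integrable_const_bound[where B = "(sqrt R * (2 ^ k * norm b))\<^sup>2"])
      show "AE w in M. norm ((V i w \<bullet> ?Z b w)\<^sup>2) \<le> (sqrt R * (2 ^ k * norm b))\<^sup>2"
        using Z_bound[of b] AE_norm_bound[of i]
      proof eventually_elim
        case (elim w)
        have "\<bar>V i w \<bullet> ?Z b w\<bar> \<le> norm (V i w) * norm (?Z b w)"
          by (rule Cauchy_Schwarz_ineq2)
        also have "\<dots> \<le> sqrt R * (2 ^ k * norm b)"
          using elim R by (intro mult_mono) auto
        finally have "\<bar>V i w \<bullet> ?Z b w\<bar>\<^sup>2 \<le> (sqrt R * (2 ^ k * norm b))\<^sup>2"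
          by (intro power_mono) auto
        then show ?case by simp
      qed
    qed simp
  qed
  have eq: "expectation (trace_pow e I (2 * k)) = expectation (\<lambda>w. \<Sum>b\<in>Basis. ?Z b w \<bullet> ?Z b w)"
  proof (rule integral_cong_AE)
    show "AE w in M. trace_pow e I (2 * k) w = (\<Sum>b\<in>Basis. ?Z b w \<bullet> ?Z b w)"
      using AE_bound
    proof eventually_elim
      case (elim w)
      interpret H: sym_pos_op "gram_minus e I (\<lambda>i. V i w)" \<delta> by (rule sym_pos_op_gram[OF elim])
      show ?case
        by (simp only: trace_pow_def H.trace_op_even power2_norm_eq_inner)
    qed
  qed measurable
  have AE_eq: "AE w in M. V i w \<bullet> (gram_minus e I (\<lambda>i. V i w) ^^ (2 * k)) (V i w)
      = (\<Sum>b\<in>Basis. (V i w \<bullet> ?Z b w)\<^sup>2)"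
    using AE_bound
  proof eventually_elim
    case (elim w)
    interpret H: sym_pos_op "gram_minus e I (\<lambda>i. V i w)" \<delta> by (rule sym_pos_op_gram[OF elim])
    show ?case
      by (simp only: H.parity_cases_funpow H.sum_inner_funpow_sq)
  qed
  have meas: "(\<lambda>w. V i w \<bullet> (gram_minus e I (\<lambda>i. V i w) ^^ (2 * k)) (V i w)) \<in> borel_measurable M"
    by (intro borel_measurable_inner borel_measurable_gram_minus_funpow) auto
  have int_sum: "integrable M (\<lambda>w. \<Sum>b\<in>Basis. (V i w \<bullet> ?Z b w)\<^sup>2)"
    using int by (intro Bochner_Integration.integrable_sum) auto
  show "integrable M (\<lambda>w. V i w \<bullet> (gram_minus e I (\<lambda>i. V i w) ^^ (2 * k)) (V i w))"
    using int_sum integrable_cong_AE[OF meas _ AE_eq] by auto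
  have eq': "expectation (\<lambda>w. V i w \<bullet> (gram_minus e I (\<lambda>i. V i w) ^^ (2 * k)) (V i w))
      = expectation (\<lambda>w. \<Sum>b\<in>Basis. (V i w \<bullet> ?Z b w)\<^sup>2)"
    by (rule integral_cong_AE[OF meas _ AE_eq]) measurable
  have "\<kappa> * expectation (trace_pow e I (2 * k)) = (\<Sum>b\<in>Basis. \<kappa> * expectation (\<lambda>w. ?Z b w \<bullet> ?Z b w))"
    unfolding eq using int by (simp add: Bochner_Integration.integral_sum sum_distrib_left)
  also have "\<dots> \<le> (\<Sum>b\<in>Basis. expectation (\<lambda>w. (V i w \<bullet> ?Z b w)\<^sup>2))"
    by (intro sum_mono indep_inner_sq_ge[OF ind AE_norm_bound Z_bound second_moment])
  also have "\<dots> = expectation (\<lambda>w. \<Sum>b\<in>Basis. (V i w \<bullet> ?Z b w)\<^sup>2)"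
    using int by (simp add: Bochner_Integration.integral_sum)
  finally show "\<kappa> * expectation (trace_pow e I (2 * k))
    \<le> expectation (\<lambda>w. V i w \<bullet> (gram_minus e I (\<lambda>i. V i w) ^^ (2 * k)) (V i w))"
    by (simp only: eq')
qed

text \<open>Each new vector multiplies the expected trace by at most
  \<open>1 - c * \<kappa> \<le> exp (- (c * \<kappa>))\<close>; with no vectors the operator is the
  identity, whose trace is the dimension.\<close>

lemma expectation_trace_pow_le:
  fixes k :: nat
  defines "c \<equiv> \<delta> / R * (1 - exp (- (real (Suc (2 * k)) * R / \<delta>) * e))"
  shows "expectation (trace_pow e I (Suc (2 * k))) \<le> exp (- (c * \<kappa>)) ^ card I * real DIM('a)"
proof -
  let ?n = "Suc (2 * k)"
  have c: "0 \<le> c" using \<delta> R e by (simp add: c_def)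
  have "finite I" by simp
  then show ?thesis
  proof (induction I rule: finite_induct)
    case empty
    have id1: "gram_minus e {} v = (id :: 'a \<Rightarrow> 'a)" for v :: "'i \<Rightarrow> 'a"
      by (simp add: gram_minus_def fun_eq_iff)
    have id2: "(id :: 'a \<Rightarrow> 'a) ^^ n = id" for n by (induction n) auto
    have "trace_pow e {} ?n = (\<lambda>w. \<Sum>b\<in>Basis. (b :: 'a) \<bullet> b)"
      unfolding trace_pow_def[abs_def] trace_op_def id1 id2 id_apply ..
    then show ?case by simp
  next
    case (insert i I)
    let ?g = "\<lambda>w. V i w \<bullet> (gram_minus e I (\<lambda>i. V i w) ^^ (2 * k)) (V i w)"
    have "AE w in M. trace_pow e (insert i I) ?n w \<le> trace_pow e I ?n w - c * ?g w"
      using AE_bound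
    proof eventually_elim
      case (elim w)
      have eq: "gram_minus e (insert i I) (\<lambda>i. V i w) = rank_one_minus (gram_minus e I (\<lambda>i. V i w)) e (V i w)"
        by (rule gram_minus_insert) fact+
      have "sym_pos_op (rank_one_minus (gram_minus e I (\<lambda>i. V i w)) e (V i w)) \<delta>"
        unfolding eq[symmetric] by (rule sym_pos_op_gram[OF elim])
      from trace_op_rank_one_minus_le[OF this e R] elim
      show ?case unfolding trace_pow_def eq c_def by blast
    qed
    then have "expectation (trace_pow e (insert i I) ?n) \<le> expectation (\<lambda>w. trace_pow e I ?n w - c * ?g w)"
      using indep_inner_gram(1)[OF \<open>i \<notin> I\<close>]
      by (intro integral_mono_AE trace_pow_integrable Bochner_Integration.integrable_diff integrable_mult_right)
    also have "\<dots> = expectation (trace_pow e I ?n) - c * expectation ?g"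
      using indep_inner_gram(1)[OF \<open>i \<notin> I\<close>] trace_pow_integrable[of I ?n]
      by (simp add: Bochner_Integration.integral_diff)
    also have "\<dots> \<le> expectation (trace_pow e I ?n) - c * (\<kappa> * expectation (trace_pow e I (2 * k)))"
      using indep_inner_gram(2)[OF \<open>i \<notin> I\<close>] c by (intro diff_left_mono mult_left_mono)
    \<comment> \<open>The drop involves the even power; passing to the smaller odd trace closes the
      recursion.\<close>
    also have "\<dots> \<le> expectation (trace_pow e I ?n) - c * (\<kappa> * expectation (trace_pow e I ?n))"
    proof -
      have "expectation (trace_pow e I ?n) \<le> expectation (trace_pow e I (2 * k))"
        using AE_trace_pow_even_odd[of I k] by (intro integral_mono_AE trace_pow_integrable) auto
      then show ?thesis using c \<kappa> by (intro diff_left_mono mult_left_mono)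
    qed
    also have "\<dots> = (1 + - (c * \<kappa>)) * expectation (trace_pow e I ?n)"
      by (simp add: algebra_simps)
    also have "\<dots> \<le> exp (- (c * \<kappa>)) * expectation (trace_pow e I ?n)"
      using AE_trace_pow_even_odd[of I k]
      by (intro mult_right_mono exp_ge_add_one_self integral_nonneg_AE) auto
    also have "\<dots> \<le> exp (- (c * \<kappa>)) * (exp (- (c * \<kappa>)) ^ card I * real DIM('a))"
      using insert.IH by (intro mult_left_mono) auto
    finally show ?case using insert.hyps by simp
  qed
qed

text \<open>Off \<open>A\<close> some unit vector \<open>x\<close> has small Gram form, hence
  \<open>x \<bullet> K x \<ge> 1 - e * \<tau>\<close> for the Gram operator \<open>K\<close>, and
  the trace is large. The condition on all \<open>z\<close> enters through an implication into the
  measurable set \<open>A\<close>, which avoids measuring an uncountable intersection.\<close>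

lemma markov_trace_pow:
  assumes \<tau>: "e * \<tau> \<le> 1" and A: "A \<in> events"
    and good: "AE w in M. (\<forall>z. \<tau> * (z \<bullet> z) \<le> (\<Sum>i\<in>UNIV. (V i w \<bullet> z)\<^sup>2)) \<longrightarrow> w \<in> A"
  shows "\<delta> * (1 - e * \<tau>) ^ (2 * k) * (1 - prob A) \<le> expectation (trace_pow e UNIV (Suc (2 * k)))"
proof -
  let ?c = "\<delta> * (1 - e * \<tau>) ^ (2 * k)"
  have "?c * (1 - prob A) = expectation (\<lambda>w. ?c * indicator (space M - A) w)"
    using A by (simp add: prob_compl)
  also have "\<dots> \<le> expectation (trace_pow e UNIV (Suc (2 * k)))"
  proof (intro integral_mono_AE trace_pow_integrable)
    show "integrable M (\<lambda>w. ?c * indicator (space M - A) w)"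
      using A by (intro integrable_mult_right integrable_real_indicator) (auto simp: emeasure_eq_measure)
    show "AE w in M. ?c * indicator (space M - A) w \<le> trace_pow e UNIV (Suc (2 * k)) w"
      using AE_bound good AE_trace_pow_even_odd[of UNIV k]
    proof eventually_elim
      case (elim w)
      interpret H: sym_pos_op "gram_minus e UNIV (\<lambda>i. V i w)" \<delta> by (rule sym_pos_op_gram) (rule elim)
      show ?case
      proof (cases "w \<in> A")
        case False
        with elim(2) obtain z where z: "(\<Sum>i\<in>UNIV. (V i w \<bullet> z)\<^sup>2) < \<tau> * (z \<bullet> z)"
          by (auto simp: not_le)
        then have "z \<noteq> 0" by auto
        define x where "x = (1 / norm z) *\<^sub>R z"
        have x: "norm x = 1" using \<open>z \<noteq> 0\<close> by (simp add: x_def)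
        have "(\<Sum>i\<in>UNIV. (V i w \<bullet> x)\<^sup>2) = (\<Sum>i\<in>UNIV. (V i w \<bullet> z)\<^sup>2) / (z \<bullet> z)"
          by (simp add: x_def power_mult_distrib power_divide sum_divide_distrib power2_norm_eq_inner)
        also have "\<dots> \<le> \<tau>" using z \<open>z \<noteq> 0\<close> by (simp add: divide_le_eq)
        finally have "e * (\<Sum>i\<in>UNIV. (V i w \<bullet> x)\<^sup>2) \<le> e * \<tau>" using e by (rule mult_left_mono)
        then have "1 - e * \<tau> \<le> x \<bullet> gram_minus e UNIV (\<lambda>i. V i w) x"
          using x by (simp add: inner_gram_minus flip: power2_norm_eq_inner)
        then have "(1 - e * \<tau>) ^ (2 * k) \<le> (x \<bullet> gram_minus e UNIV (\<lambda>i. V i w) x) ^ (2 * k)"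
          using \<tau> by (intro power_mono) auto
        also have "\<dots> \<le> trace_op (gram_minus e UNIV (\<lambda>i. V i w) ^^ (2 * k))"
          by (rule H.power_le_trace_op[OF x])
        finally have "?c \<le> \<delta> * trace_op (gram_minus e UNIV (\<lambda>i. V i w) ^^ (2 * k))"
          using \<delta> by simp
        also have "\<dots> \<le> trace_op (gram_minus e UNIV (\<lambda>i. V i w) ^^ Suc (2 * k))"
          by (rule H.trace_op_odd_ge)
        finally show ?thesis
          using elim(3) by (simp add: trace_pow_def indicator_def del: funpow.simps)
      qed (use elim in simp)
    qed
  qed
  finally show ?thesis .
qed

end

text \<open>Markov's inequality for the odd power \<open>n\<close> with step \<open>s / n\<close>,
  followed by \<open>n\<close> to infinity: the powers on the left tend to exponentials and \<delta>
  tends to 1.\<close>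

lemma tail_bound_exp:
  assumes s: "0 < s" and \<tau>: "0 \<le> \<tau>" and A: "A \<in> events"
    and good: "AE w in M. (\<forall>z. \<tau> * (z \<bullet> z) \<le> (\<Sum>i\<in>UNIV. (V i w \<bullet> z)\<^sup>2)) \<longrightarrow> w \<in> A"
  shows "exp (- s * \<tau>) * (1 - prob A)
    \<le> exp (- (1 / R * (1 - exp (- (s * R))) * \<kappa>)) ^ CARD('i) * real DIM('a)"
proof (rule LIMSEQ_le)
  define n where "n k = Suc (2 * k)" for k :: nat
  \<comment> \<open>The largest value that the smallness condition admits for the step
    \<open>s / n k\<close>.\<close>
  define \<delta> where "\<delta> k = 1 - s * real CARD('i) * R / real (n k)" for k
  have n_lim: "filterlim (\<lambda>k. real (n k)) at_top sequentially"
    unfolding n_def by (rule filterlim_compose[OF filterlim_real_sequentially])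
      (rule filterlim_subseq, simp add: strict_mono_def)
  have frac: "(\<lambda>k. y / real (n k)) \<longlonglongrightarrow> 0" for y :: real
    by (rule tendsto_divide_0[OF tendsto_const filterlim_at_top_imp_at_infinity[OF n_lim]])
  have \<delta>_lim: "\<delta> \<longlonglongrightarrow> 1"
    using tendsto_diff[OF tendsto_const[of 1] frac[of "s * real CARD('i) * R"]]
    by (simp add: \<delta>_def[abs_def])
  have "(\<lambda>k. (1 + (- (s * \<tau>)) / real (n k)) ^ n k) \<longlonglongrightarrow> exp (- (s * \<tau>))"
    using LIMSEQ_subseq_LIMSEQ[OF tendsto_exp_limit_sequentially[of "- (s * \<tau>)"], of n]
    by (simp add: n_def strict_mono_def comp_def)
  then have "(\<lambda>k. \<delta> k * (1 - s * \<tau> / real (n k)) ^ n k * (1 - prob A)) \<longlonglongrightarrow> 1 * exp (- (s * \<tau>)) * (1 - prob A)"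
    by (intro tendsto_mult \<delta>_lim tendsto_const) simp
  then show "(\<lambda>k. \<delta> k * (1 - s * \<tau> / real (n k)) ^ n k * (1 - prob A)) \<longlonglongrightarrow> exp (- s * \<tau>) * (1 - prob A)"
    by simp
  have "(\<lambda>k. exp (- (\<delta> k / R * (1 - exp (- (s * R / \<delta> k))) * \<kappa>)) ^ CARD('i) * real DIM('a))
      \<longlonglongrightarrow> exp (- (1 / R * (1 - exp (- (s * R / 1))) * \<kappa>)) ^ CARD('i) * real DIM('a)"
    using R by (intro tendsto_intros \<delta>_lim) auto
  then show "(\<lambda>k. exp (- (\<delta> k / R * (1 - exp (- (s * R / \<delta> k))) * \<kappa>)) ^ CARD('i) * real DIM('a))
      \<longlonglongrightarrow> exp (- (1 / R * (1 - exp (- (s * R))) * \<kappa>)) ^ CARD('i) * real DIM('a)"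
    by simp
  have "\<forall>\<^sub>F k in sequentially. 0 < \<delta> k"
    using order_tendstoD(1)[OF \<delta>_lim] by simp
  moreover have "\<forall>\<^sub>F k in sequentially. s * \<tau> / real (n k) < 1"
    using order_tendstoD(2)[OF frac] by simp
  ultimately have "\<forall>\<^sub>F k in sequentially. \<delta> k * (1 - s * \<tau> / real (n k)) ^ n k * (1 - prob A)
      \<le> exp (- (\<delta> k / R * (1 - exp (- (s * R / \<delta> k))) * \<kappa>)) ^ CARD('i) * real DIM('a)"
  proof eventually_elim
    case (elim k)
    define e where "e = s / real (n k)"
    have e: "0 \<le> e" "e * (real CARD('i) * R) \<le> 1 - \<delta> k" "e * \<tau> \<le> 1"
      using s elim by (simp_all add: e_def \<delta>_def)
    have p: "s * \<tau> / real (n k) = e * \<tau>" by (simp add: e_def)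
    \<comment> \<open>The base lies in [0, 1], so raising the exponent from \<open>2 * k\<close> to
      \<open>n k\<close> only weakens the bound and produces the standard exponential
      sequence.\<close>
    have "(1 - s * \<tau> / real (n k)) ^ n k \<le> (1 - e * \<tau>) ^ (2 * k)"
      unfolding p using e(1,3) \<tau> by (intro power_decreasing) (auto simp: n_def)
    then have "\<delta> k * (1 - s * \<tau> / real (n k)) ^ n k * (1 - prob A)
      \<le> \<delta> k * (1 - e * \<tau>) ^ (2 * k) * (1 - prob A)"
      using elim(1) by (intro mult_right_mono mult_left_mono) auto
    also have "\<dots> \<le> expectation (trace_pow e UNIV (Suc (2 * k)))"
      by (rule markov_trace_pow[OF e(1) elim(1) e(2,3) A good])
    also have "\<dots> \<le> exp (- (\<delta> k / R * (1 - exp (- (real (Suc (2 * k)) * R / \<delta> k) * e)) * \<kappa>)) ^ CARD('i) * real DIM('a)"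
      by (rule expectation_trace_pow_le[OF e(1) elim(1) e(2)])
    also have "(real (Suc (2 * k)) * R / \<delta> k) * e = s * R / \<delta> k"
      by (simp add: e_def n_def del: of_nat_Suc)
    then have "exp (- (real (Suc (2 * k)) * R / \<delta> k) * e) = exp (- (s * R / \<delta> k))"
      by (simp only: mult_minus_left)
    finally show ?case .
  qed
  then show "\<exists>N. \<forall>k\<ge>N. \<delta> k * (1 - s * \<tau> / real (n k)) ^ n k * (1 - prob A)
      \<le> exp (- (\<delta> k / R * (1 - exp (- (s * R / \<delta> k))) * \<kappa>)) ^ CARD('i) * real DIM('a)"
    by (simp add: eventually_sequentially)
qed

lemma matrix_chernoff_lower:
  assumes t: "0 < t" "t < 1" and A: "A \<in> events"
    and good: "AE w in M. (\<forall>z. t * real CARD('i) * \<kappa> * (z \<bullet> z) \<le> (\<Sum>i\<in>UNIV. (V i w \<bullet> z)\<^sup>2)) \<longrightarrow> w \<in> A"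
  shows "1 - real DIM('a) * exp (- ((1 - t)\<^sup>2 * real CARD('i) * \<kappa> / (2 * R))) \<le> prob A"
proof -
  \<comment> \<open>This minimises
    \<open>s * \<tau> - N * \<kappa> * (1 - exp (- s * R)) / R\<close> for
    \<open>\<tau> = t * N * \<kappa>\<close>, where \<open>N\<close> is the number of vectors: the
    derivative vanishes when \<open>exp (- s * R) = t\<close>.\<close>
  define s where "s = - ln t / R"
  define y where "y = real CARD('i) * \<kappa> / R"
  have s: "0 < s" using t R by (simp add: s_def divide_less_0_iff)
  have y: "0 \<le> y" using \<kappa> R by (simp add: y_def)
  have et: "exp (- (s * R)) = t" using R t by (simp add: s_def)
  have "exp (- s * (t * real CARD('i) * \<kappa>)) * (1 - prob A)
    \<le> exp (- (1 / R * (1 - exp (- (s * R))) * \<kappa>)) ^ CARD('i) * real DIM('a)"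
    using t \<kappa> by (intro tail_bound_exp[OF s _ A good]) auto
  also have "exp (- (1 / R * (1 - exp (- (s * R))) * \<kappa>)) ^ CARD('i) = exp (- ((1 - t) * y))"
  proof -
    have "real CARD('i) * - (1 / R * (1 - t) * \<kappa>) = - ((1 - t) * y)" by (simp add: y_def mult_ac)
    then show ?thesis unfolding et by (simp only: exp_of_nat_mult[symmetric])
  qed
  also have "- s * (t * real CARD('i) * \<kappa>) = t * ln t * y"
    by (simp add: s_def y_def)
  finally have le: "exp (t * ln t * y) * (1 - prob A) \<le> exp (- ((1 - t) * y)) * real DIM('a)" .
  have "1 - prob A = exp (- (t * ln t * y)) * (exp (t * ln t * y) * (1 - prob A))"
    by (simp add: exp_minus)
  also have "\<dots> \<le> exp (- (t * ln t * y)) * (exp (- ((1 - t) * y)) * real DIM('a))"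
    by (intro mult_left_mono le) simp
  also have "\<dots> = exp (- (t * ln t * y) + - ((1 - t) * y)) * real DIM('a)"
    by (simp only: exp_add mult.assoc)
  also have "- (t * ln t * y) + - ((1 - t) * y) = - ((t * ln t + 1 - t) * y)"
    by (simp add: algebra_simps)
  also have "exp (- ((t * ln t + 1 - t) * y)) * real DIM('a) \<le> exp (- ((1 - t)\<^sup>2 / 2 * y)) * real DIM('a)"
    using mult_right_mono[OF xlnx_ge y, of t] t by (intro mult_right_mono) auto
  finally show ?thesis by (simp add: y_def mult_ac)
qed

end

section \<open>Spectral theorem and polar factor\<close>

text \<open>For small \<open>t\<close> with the sign of \<alpha> the linear term would win. This
  serves as the first-order condition at a maximum of the Rayleigh quotient.\<close>

lemma eq_0_if_linear_le_quadratic: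
  fixes \<alpha> \<beta> :: real
  assumes "\<And>t. t * \<alpha> \<le> t\<^sup>2 * \<beta>"
  shows "\<alpha> = 0"
proof (rule ccontr)
  assume "\<alpha> \<noteq> 0"
  define t where "t = \<alpha> / (\<bar>\<beta>\<bar> + 1)"
  have p: "0 < \<bar>\<beta>\<bar> + 1" by simp
  have "t\<^sup>2 * (\<bar>\<beta>\<bar> + 1) = t * \<alpha>"
    using p by (simp add: t_def power2_eq_square)
  also have "\<dots> \<le> t\<^sup>2 * \<beta>" by (rule assms)
  also have "\<dots> \<le> t\<^sup>2 * \<bar>\<beta>\<bar>" by (intro mult_left_mono) auto
  finally have "t\<^sup>2 \<le> 0" by (simp add: distrib_left)
  then show False using \<open>\<alpha> \<noteq> 0\<close> p by (simp add: t_def)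
qed

text \<open>A maximiser \<open>u\<close> of \<open>x \<bullet> T x\<close> on the unit sphere of
  \<open>S\<close> is stationary. Varying it along the residual \<open>T u - l u\<close>, which lies
  in \<open>S\<close> and is orthogonal to \<open>u\<close>, shows that the residual is orthogonal
  to itself.\<close>

lemma symmetric_op_ex_eigenvector:
  fixes T :: "'a::euclidean_space \<Rightarrow> 'a"
  assumes lin: "linear T" and sym: "\<And>x y. x \<bullet> T y = T x \<bullet> y"
    and S: "subspace S" and inv: "T ` S \<subseteq> S" and ne: "S \<noteq> {0}"
  obtains u l where "u \<in> S" "norm u = 1" "T u = l *\<^sub>R u"
proof -
  let ?C = "S \<inter> sphere 0 1"
  have "compact ?C" by (intro closed_Int_compact closed_subspace S compact_sphere)
  moreover obtain y where y: "y \<in> S" "y \<noteq> 0" using ne S subspace_0 by blast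
  have "(1 / norm y) *\<^sub>R y \<in> ?C" using y subspace_scale[OF S] by simp
  then have "?C \<noteq> {}" by blast
  moreover have "continuous_on ?C (\<lambda>x. x \<bullet> T x)"
    using linear_continuous_on[of T] lin
    by (intro continuous_intros) (auto simp: linear_conv_bounded_linear)
  ultimately obtain u where u: "u \<in> ?C" and max: "\<And>x. x \<in> ?C \<Longrightarrow> x \<bullet> T x \<le> u \<bullet> T u"
    using continuous_attains_sup by meson
  define l where "l = u \<bullet> T u"
  have u1: "u \<in> S" "norm u = 1" "u \<bullet> u = 1" using u by (auto simp: dot_square_norm)
  have le: "x \<bullet> T x \<le> l * (x \<bullet> x)" if "x \<in> S" for x
  proof (cases "x = 0")
    case False
    have "(1 / norm x) *\<^sub>R x \<in> ?C" using that False subspace_scale[OF S] by simp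
    from max[OF this] show ?thesis
      using False by (simp add: l_def linear_scale[OF lin] dot_square_norm field_simps power2_eq_square)
  qed (simp add: linear_0[OF lin])
  let ?w = "T u - l *\<^sub>R u"
  have wS: "?w \<in> S" using u1 inv S by (auto intro!: subspace_diff subspace_scale)
  have uw: "u \<bullet> ?w = 0" by (simp add: inner_diff_right u1 l_def)
  have "?w \<bullet> T u = 0"
  proof -
    have "t * (2 * (?w \<bullet> T u)) \<le> t\<^sup>2 * (l * (?w \<bullet> ?w) - ?w \<bullet> T ?w)" for t
    proof -
      have "u + t *\<^sub>R ?w \<in> S" using u1 wS S by (intro subspace_add subspace_scale) auto
      from le[OF this] have "(u + t *\<^sub>R ?w) \<bullet> (T u + t *\<^sub>R T ?w)
          \<le> l * ((u + t *\<^sub>R ?w) \<bullet> (u + t *\<^sub>R ?w))"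
        by (simp only: linear_add[OF lin] linear_scale[OF lin])
      moreover have "u \<bullet> T ?w = ?w \<bullet> T u" by (simp add: sym[of u ?w] inner_commute)
      moreover have "?w \<bullet> u = 0" using uw by (simp add: inner_commute)
      ultimately show ?thesis
        unfolding inner_add_left inner_add_right inner_scaleR_left inner_scaleR_right
        using uw by (simp add: u1 l_def[symmetric] power2_eq_square algebra_simps del: inner_diff_left inner_diff_right)
    qed
    from eq_0_if_linear_le_quadratic[OF this] show ?thesis by simp
  qed
  moreover have "?w \<bullet> ?w = ?w \<bullet> T u - l * (u \<bullet> ?w)"
    by (metis inner_commute inner_diff_right inner_scaleR_right)
  ultimately have "?w \<bullet> ?w = 0" using uw by simp
  then have "T u = l *\<^sub>R u" by simp
  with u1 that show ?thesis by blast
qed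

text \<open>Induction on the dimension: by symmetry the part of \<open>S\<close> orthogonal to an
  eigenvector is again invariant.\<close>

lemma symmetric_op_orthonormal_eigenbasis:
  fixes T :: "'a::euclidean_space \<Rightarrow> 'a"
  assumes lin: "linear T" and sym: "\<And>x y. x \<bullet> T y = T x \<bullet> y"
    and "subspace S" "T ` S \<subseteq> S"
  shows "\<exists>B. finite B \<and> B \<subseteq> S \<and> S \<subseteq> span B \<and> pairwise orthogonal B \<and>
    (\<forall>b\<in>B. norm b = 1 \<and> T b = (b \<bullet> T b) *\<^sub>R b)"
  using assms(3,4)
proof (induction "dim S" arbitrary: S rule: less_induct)
  case less
  note S = less.prems(1) and inv = less.prems(2)
  show ?case
  proof (cases "S = {0}")
    case True
    then show ?thesis by (intro exI[of _ "{}"]) auto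
  next
    case False
    from symmetric_op_ex_eigenvector[OF lin sym S inv False]
    obtain u l where u: "u \<in> S" "norm u = 1" "T u = l *\<^sub>R u" by blast
    have uu: "u \<bullet> u = 1" using u by (simp add: dot_square_norm)
    let ?S = "S \<inter> {x. u \<bullet> x = 0}"
    have S': "subspace ?S" using subspace_inter[OF S subspace_hyperplane] .
    have "T ` ?S \<subseteq> ?S"
      using inv by (auto simp: sym u)
    moreover have "dim ?S < dim S"
    proof (rule dim_psubset)
      have "u \<notin> ?S" using uu by simp
      then have "?S \<subset> S" using u by blast
      then show "span ?S \<subset> span S" using span_eq_iff S S' by metis
    qed
    ultimately obtain B where B: "finite B" "B \<subseteq> ?S" "?S \<subseteq> span B" "pairwise orthogonal B"
      "\<forall>b\<in>B. norm b = 1 \<and> T b = (b \<bullet> T b) *\<^sub>R b"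
      using less.hyps[OF _ S'] by blast
    show ?thesis
    proof (intro exI[of _ "insert u B"] conjI)
      show "S \<subseteq> span (insert u B)"
      proof
        fix x assume x: "x \<in> S"
        have "x - (u \<bullet> x) *\<^sub>R u \<in> ?S"
          using x u S uu by (auto intro!: subspace_diff subspace_scale simp: inner_diff_right)
        then show "x \<in> span (insert u B)" using B(3) by (auto simp: span_breakdown_eq)
      qed
      show "pairwise orthogonal (insert u B)"
        using B(2,4) by (auto simp: pairwise_insert orthogonal_def inner_commute)
      show "\<forall>b\<in>insert u B. norm b = 1 \<and> T b = (b \<bullet> T b) *\<^sub>R b"
        using B(5) u uu by auto
    qed (use B u in auto)
  qed
qed

lemma matrix_eqI_on_spanning:
  fixes A B :: "real ^ 'l ^ 'k"
  assumes "\<And>x. x \<in> E \<Longrightarrow> A *v x = B *v x" "UNIV \<subseteq> span E"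
  shows "A = B"
  using linear_eq_on_span[OF matrix_vector_mul_linear matrix_vector_mul_linear assms(1)] assms(2)
  by (auto simp: matrix_eq)

text \<open>Existence matters because \<open>A1\<close> quantifies over all decompositions and would
  hold vacuously if there were none.\<close>

lemma symmetric_matrix_ex_compact_svd:
  fixes M :: "real ^ 'n ^ 'n"
  assumes M: "transpose M = M"
  obtains q s u v where "compact_svd M q s u v"
proof -
  have sym: "x \<bullet> (M *v y) = (M *v x) \<bullet> y" for x y
    using dot_lmul_matrix[of x M y] M by (metis transpose_matrix_vector)
  obtain B where B: "finite B" "UNIV \<subseteq> span B" "pairwise orthogonal B"
    "\<forall>b\<in>B. norm b = 1 \<and> M *v b = (b \<bullet> (M *v b)) *\<^sub>R b"
    using symmetric_op_orthonormal_eigenbasis[OF matrix_vector_mul_linear sym subspace_UNIV]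
    by blast
  define l where "l b = b \<bullet> (M *v b)" for b
  have Mb: "M *v b = l b *\<^sub>R b" if "b \<in> B" for b using B(4) that by (simp add: l_def)
  have on: "b \<bullet> b' = (if b = b' then 1 else 0)" if "b \<in> B" "b' \<in> B" for b b'
    using B(3,4) that by (auto simp: pairwise_def orthogonal_def dot_square_norm)
  define C where "C = {b \<in> B. l b \<noteq> 0}"
  have C: "finite C" "C \<subseteq> B" using B(1) by (auto simp: C_def)
  obtain h where h: "bij_betw h {..<card C} C"
    using C(1) bij_betw_from_nat_into_finite by blast
  have hC: "h i \<in> C" if "i < card C" for i using h that by (auto simp: bij_betw_def)
  have h_inj: "h i = h j \<longleftrightarrow> i = j" if "i < card C" "j < card C" for i j
    using h that by (auto simp: bij_betw_def inj_on_def)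
  have hB: "h i \<in> B" if "i < card C" for i using hC[OF that] C by blast
  \<comment> \<open>An eigenvalue may be negative; its sign goes into the left singular vector so
    that the singular value is positive.\<close>
  define s u where "s i = \<bar>l (h i)\<bar>" and "u i = sgn (l (h i)) *\<^sub>R h i" for i
  have sq: "sgn (l (h i)) * sgn (l (h i)) = 1" if "i < card C" for i
    using hC[OF that] by (auto simp: C_def sgn_if)
  have s_u: "s i *\<^sub>R outer (u i) (h i) *v b = (l (h i) * (h i \<bullet> b)) *\<^sub>R h i" for i b
    unfolding scaleR_matrix_vector_assoc[symmetric] outer_mult_vec s_def u_def
    by (cases "l (h i)" "0 :: real" rule: linorder_cases) auto
  have "span (columns M) = span C"
  proof (rule antisym)
    have "M *v x \<in> span C" for x
    proof -
      have "x \<in> span B" using B(2) by blast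
      then show ?thesis
      proof (induction rule: span_induct_alt)
        case (step c b y)
        have "M *v b \<in> span C"
          using step(1) span_scale[OF span_base, of b C "l b"]
          by (cases "l b = 0") (auto simp: Mb C_def span_zero)
        then show ?case
          using step by (simp add: matrix_vector_right_distrib matrix_vector_mult_scaleR span_add span_scale)
      qed (simp add: span_zero)
    qed
    then show "span (columns M) \<subseteq> span C" by (auto simp: span_columns_eq_range)
    have "b \<in> range ((*v) M)" if "b \<in> C" for b
    proof -
      have "M *v ((1 / l b) *\<^sub>R b) = b"
        using that C(2) Mb[of b] by (auto simp: matrix_vector_mult_scaleR C_def)
      then show ?thesis by (metis rangeI)
    qed
    then show "span C \<subseteq> span (columns M)"
      by (metis span_columns_eq_range span_minimal subsetI subspace_span)
  qed
  then have "rank M = dim C" by (metis dim_span rank_dim_range span_columns_eq_range)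
  also have "\<dots> = card C"
  proof (rule dim_eq_card_independent[OF pairwise_orthogonal_independent])
    show "pairwise orthogonal C" using B(3) C(2) by (rule pairwise_subset)
    show "0 \<notin> C" using B(4) C(2) by force
  qed
  finally have rank: "card C = rank M" by simp
  have "M = (\<Sum>i<card C. s i *\<^sub>R outer (u i) (h i))"
  proof (rule matrix_eqI_on_spanning[OF _ B(2)])
    fix b assume b: "b \<in> B"
    have "(\<Sum>i<card C. s i *\<^sub>R outer (u i) (h i)) *v b
      = (\<Sum>i<card C. (l (h i) * (h i \<bullet> b)) *\<^sub>R h i)"
      by (simp add: sum_matrix_vector_mult s_u)
    also have "\<dots> = (\<Sum>c\<in>C. (l c * (c \<bullet> b)) *\<^sub>R c)"
      by (rule sum.reindex_bij_betw[OF h])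
    also have "\<dots> = (\<Sum>c\<in>C. if c = b then l b *\<^sub>R b else 0)"
      using on b C(2) by (intro sum.cong) auto
    also have "\<dots> = M *v b"
      using C(1) b by (auto simp: Mb C_def)
    finally show "M *v b = (\<Sum>i<card C. s i *\<^sub>R outer (u i) (h i)) *v b" by simp
  qed
  moreover have "\<forall>i<card C. 0 < s i" using hC by (auto simp: s_def C_def)
  moreover have "\<forall>i<card C. \<forall>j<card C. u i \<bullet> u j = (if i = j then 1 else 0)"
    using hB on h_inj sq by (auto simp: u_def)
  moreover have "\<forall>i<card C. \<forall>j<card C. h i \<bullet> h j = (if i = j then 1 else 0)"
    using hB on h_inj by auto
  ultimately have "compact_svd M (card C) s u h"
    unfolding compact_svd_def using rank by blast
  then show ?thesis by (rule that)
qed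


section \<open>The polar factor as a limit of Newton-Schulz iterates\<close>

definition newton_schulz :: "real ^ 'l ^ 'k \<Rightarrow> real ^ 'l ^ 'k" where
  "newton_schulz W = (3 / 2) *\<^sub>R W - (1 / 2) *\<^sub>R (W ** transpose W ** W)"

text \<open>The scaling brings the singular values into \<open>(0, 1]\<close>, where the Newton-Schulz iteration
  converges to \<open>1\<close>.\<close>

definition polar_iter :: "nat \<Rightarrow> real ^ 'l ^ 'k \<Rightarrow> real ^ 'l ^ 'k" where
  "polar_iter k M = (newton_schulz ^^ k) ((1 / (1 + (\<Sum>i\<in>UNIV. \<Sum>j\<in>UNIV. \<bar>M $ i $ j\<bar>))) *\<^sub>R M)"

text \<open>A limit of explicit iterates replaces the sum over singular vectors, whose choice need
  not be measurable in the matrix.\<close>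

definition polar :: "real ^ 'l ^ 'k \<Rightarrow> real ^ 'l ^ 'k" where
  "polar M = (\<chi> i j. lim (\<lambda>k. polar_iter k M $ i $ j))"

lemma sum_outer_mult_vec:
  "(\<Sum>i\<in>S. a i *\<^sub>R outer (u i) (v i)) *v x = (\<Sum>i\<in>S. (a i * (v i \<bullet> x)) *\<^sub>R u i)"
  by (simp add: sum_matrix_vector_mult outer_mult_vec flip: scaleR_matrix_vector_assoc)

lemma transpose_sum_outer:
  "transpose (\<Sum>i\<in>S. a i *\<^sub>R outer (u i) (v i)) = (\<Sum>i\<in>S. a i *\<^sub>R outer (v i) (u i))"
  by (simp add: vec_eq_iff transpose_def outer_def mult_ac)

lemma orthonormal_inner_sum:
  fixes u :: "nat \<Rightarrow> 'a::real_inner"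
  assumes "\<forall>i<q. \<forall>j<q. u i \<bullet> u j = (if i = j then 1 else 0)" "i < q"
  shows "u i \<bullet> (\<Sum>j<q. c j *\<^sub>R u j) = c i"
proof -
  have "u i \<bullet> (\<Sum>j<q. c j *\<^sub>R u j) = (\<Sum>j<q. if i = j then c j else 0)"
    unfolding inner_sum_right using assms by (intro sum.cong) auto
  then show ?thesis using assms(2) by simp
qed

lemma orthonormal_sum_inner_self:
  fixes u :: "nat \<Rightarrow> 'a::real_inner"
  assumes "\<forall>i<q. \<forall>j<q. u i \<bullet> u j = (if i = j then 1 else 0)"
  shows "(\<Sum>j<q. c j *\<^sub>R u j) \<bullet> (\<Sum>j<q. c j *\<^sub>R u j) = (\<Sum>j<q. (c j)\<^sup>2)"
  by (subst inner_sum_left) (simp add: orthonormal_inner_sum[OF assms] power2_eq_square)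

text \<open>By orthonormality \<open>W W^T W\<close> cubes the coefficients and keeps the vectors.
  Zero singular values stay at zero, so a rank-deficient matrix causes no trouble.\<close>

lemma newton_schulz_sum_outer:
  fixes u :: "nat \<Rightarrow> real ^ 'k" and v :: "nat \<Rightarrow> real ^ 'l"
  assumes u: "\<forall>i<q. \<forall>j<q. u i \<bullet> u j = (if i = j then 1 else 0)"
    and v: "\<forall>i<q. \<forall>j<q. v i \<bullet> v j = (if i = j then 1 else 0)"
  shows "newton_schulz (\<Sum>i<q. a i *\<^sub>R outer (u i) (v i))
    = (\<Sum>i<q. ((3 * a i - a i ^ 3) / 2) *\<^sub>R outer (u i) (v i))"
proof (subst matrix_eq, rule allI)
  fix x
  let ?W = "\<Sum>i<q. a i *\<^sub>R outer (u i) (v i)"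
  have WtW: "transpose ?W *v (?W *v x) = (\<Sum>i<q. (a i * (a i * (v i \<bullet> x))) *\<^sub>R v i)"
    unfolding transpose_sum_outer sum_outer_mult_vec
    by (intro sum.cong refl) (simp add: orthonormal_inner_sum[OF u])
  have WWtW: "?W *v (transpose ?W *v (?W *v x)) = (\<Sum>i<q. (a i * (a i * (a i * (v i \<bullet> x)))) *\<^sub>R u i)"
    unfolding WtW unfolding sum_outer_mult_vec
    by (intro sum.cong refl) (simp add: orthonormal_inner_sum[OF v])
  have "newton_schulz ?W *v x = (3 / 2) *\<^sub>R (?W *v x) - (1 / 2) *\<^sub>R (?W *v (transpose ?W *v (?W *v x)))"
    by (simp only: newton_schulz_def matrix_vector_mult_diff_rdistrib
        matrix_vector_mul_assoc scaleR_matrix_vector_assoc matrix_mul_assoc)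
  also have "\<dots> = (3 / 2) *\<^sub>R (\<Sum>i<q. (a i * (v i \<bullet> x)) *\<^sub>R u i)
      - (1 / 2) *\<^sub>R (\<Sum>i<q. (a i * (a i * (a i * (v i \<bullet> x)))) *\<^sub>R u i)"
    unfolding WWtW unfolding sum_outer_mult_vec ..
  also have "\<dots> = (\<Sum>i<q. ((3 * a i - a i ^ 3) / 2 * (v i \<bullet> x)) *\<^sub>R u i)"
    unfolding scaleR_sum_right sum_subtractf[symmetric]
  proof (rule sum.cong[OF refl])
    fix i
    have "3 / 2 * (a i * (v i \<bullet> x)) - 1 / 2 * (a i * (a i * (a i * (v i \<bullet> x))))
        = (3 * a i - a i ^ 3) / 2 * (v i \<bullet> x)"
      by (simp add: power3_eq_cube field_simps)
    then show "(3 / 2) *\<^sub>R (a i * (v i \<bullet> x)) *\<^sub>R u i - (1 / 2) *\<^sub>R (a i * (a i * (a i * (v i \<bullet> x)))) *\<^sub>R u i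
        = ((3 * a i - a i ^ 3) / 2 * (v i \<bullet> x)) *\<^sub>R u i"
      by (simp only: scaleR_scaleR scaleR_left_diff_distrib[symmetric])
  qed
  finally show "newton_schulz ?W *v x = (\<Sum>i<q. ((3 * a i - a i ^ 3) / 2) *\<^sub>R outer (u i) (v i)) *v x"
    by (simp add: sum_outer_mult_vec)
qed

text \<open>The error satisfies \<open>1 - ?f y = (1 - y) * (1 - (y + y\<^sup>2) / 2)\<close>, and
  the iterates never fall below \<open>x\<close>, so each step shrinks it by at least the factor
  \<open>1 - x / 2\<close>.\<close>

lemma newton_schulz_scalar_tendsto:
  fixes x :: real
  assumes x: "0 < x" "x \<le> 1"
  shows "(\<lambda>k. ((\<lambda>y. (3 * y - y ^ 3) / 2) ^^ k) x) \<longlonglongrightarrow> 1"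
proof -
  let ?f = "\<lambda>y::real. (3 * y - y ^ 3) / 2"
  have inv: "x \<le> (?f ^^ k) x \<and> (?f ^^ k) x \<le> 1 \<and> 1 - (?f ^^ k) x \<le> (1 - x / 2) ^ k" for k
  proof (induction k)
    case 0
    then show ?case using x by simp
  next
    case (Suc k)
    define y where "y = (?f ^^ k) x"
    have y: "x \<le> y" "y \<le> 1" "1 - y \<le> (1 - x / 2) ^ k" using Suc by (simp_all add: y_def)
    have y0: "0 < y" using x y by simp
    have f: "1 - ?f y = (1 - y) * (1 - (y + y\<^sup>2) / 2)" "?f y - y = y * ((1 - y) * (1 + y)) / 2"
      by (simp_all add: power3_eq_cube power2_eq_square field_simps)
    have y2: "y\<^sup>2 \<le> 1" "0 \<le> y\<^sup>2" using y y0 by (simp_all add: power_le_one)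
    have "0 \<le> ?f y - y" unfolding f using y y0 by simp
    moreover have "0 \<le> 1 - ?f y" unfolding f(1) using y y2 by (intro mult_nonneg_nonneg) auto
    moreover have "1 - ?f y \<le> (1 - x / 2) ^ Suc k"
    proof -
      have "1 - ?f y \<le> (1 - y) * (1 - x / 2)"
        unfolding f(1)
      proof (rule mult_left_mono)
        show "1 - (y + y\<^sup>2) / 2 \<le> 1 - x / 2" using y(1) y2(2) by argo
      qed (use y in simp)
      also have "\<dots> \<le> (1 - x / 2) ^ k * (1 - x / 2)"
        using y x by (intro mult_right_mono) auto
      finally show ?thesis by (simp add: mult.commute)
    qed
    ultimately show ?case using y by (simp add: y_def[symmetric])
  qed
  have "(\<lambda>k. 1 - (?f ^^ k) x) \<longlonglongrightarrow> 0"
  proof (rule tendsto_sandwich[OF always_eventually always_eventually tendsto_const])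
    show "(\<lambda>k. (1 - x / 2) ^ k) \<longlonglongrightarrow> 0"
      using x by (intro LIMSEQ_power_zero) simp
  qed (use inv in auto)
  from tendsto_diff[OF tendsto_const[of 1] this] show ?thesis by simp
qed

text \<open>As \<open>polar\<close> is defined from the matrix alone, this also shows that the sum
  is the same for every compact decomposition.\<close>

lemma polar_compact_svd:
  fixes M :: "real ^ 'l ^ 'k"
  assumes svd: "compact_svd M q s u v"
  shows "polar M = (\<Sum>i<q. outer (u i) (v i))"
proof -
  have M: "M = (\<Sum>i<q. s i *\<^sub>R outer (u i) (v i))"
    and s: "\<And>i. i < q \<Longrightarrow> 0 < s i"
    and u: "\<forall>i<q. \<forall>j<q. u i \<bullet> u j = (if i = j then 1 else 0)"
    and v: "\<forall>i<q. \<forall>j<q. v i \<bullet> v j = (if i = j then 1 else 0)"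
    using svd unfolding compact_svd_def by blast+
  define c where "c = 1 + (\<Sum>i\<in>UNIV. \<Sum>j\<in>UNIV. \<bar>M $ i $ j\<bar>)"
  have c: "1 \<le> c" by (simp add: c_def sum_nonneg)
  \<comment> \<open>The scaling must bring every singular value into (0, 1]. Here \<open>s i\<close>
    is the form of \<open>M\<close> at the unit vectors \<open>u i\<close> and \<open>v i\<close>,
    whose entries are at most 1 in absolute value.\<close>
  have s_le: "s i \<le> c" if "i < q" for i
  proof -
    have "M *v v i = (\<Sum>j<q. (s j * (v j \<bullet> v i)) *\<^sub>R u j)"
      by (subst M) (rule sum_outer_mult_vec)
    then have "u i \<bullet> (M *v v i) = s i"
      using v that by (simp add: orthonormal_inner_sum[OF u that])
    moreover have "u i \<bullet> (M *v v i) = (\<Sum>k\<in>UNIV. \<Sum>l\<in>UNIV. u i $ k * (M $ k $ l * v i $ l))"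
      by (simp add: inner_vec_def matrix_vector_mult_def sum_distrib_left)
    moreover have "u i $ k * (M $ k $ l * v i $ l) \<le> \<bar>M $ k $ l\<bar>" for k l
    proof -
      have "norm (u i) = 1" "norm (v i) = 1"
        using u v that by (simp_all add: norm_eq_sqrt_inner)
      then have "\<bar>u i $ k\<bar> \<le> 1" "\<bar>v i $ l\<bar> \<le> 1"
        by (metis component_le_norm_cart)+
      then have "\<bar>u i $ k\<bar> * (\<bar>M $ k $ l\<bar> * \<bar>v i $ l\<bar>) \<le> 1 * (\<bar>M $ k $ l\<bar> * 1)"
        by (intro mult_mono) auto
      then have "\<bar>u i $ k * (M $ k $ l * v i $ l)\<bar> \<le> \<bar>M $ k $ l\<bar>"
        by (simp add: abs_mult)
      then show ?thesis by linarith
    qed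
    then have "(\<Sum>k\<in>UNIV. \<Sum>l\<in>UNIV. u i $ k * (M $ k $ l * v i $ l))
        \<le> (\<Sum>k\<in>UNIV. \<Sum>l\<in>UNIV. \<bar>M $ k $ l\<bar>)"
      by (intro sum_mono)
    ultimately have "s i \<le> (\<Sum>k\<in>UNIV. \<Sum>l\<in>UNIV. \<bar>M $ k $ l\<bar>)"
      by linarith
    then show ?thesis by (simp add: c_def)
  qed
  let ?f = "\<lambda>y::real. (3 * y - y ^ 3) / 2"
  have iter: "polar_iter k M = (\<Sum>i<q. (?f ^^ k) (s i / c) *\<^sub>R outer (u i) (v i))" for k
  proof (induction k)
    case 0
    show ?case
      unfolding polar_iter_def c_def[symmetric]
      by (subst M) (simp add: scaleR_sum_right)
  next
    case (Suc k)
    have "polar_iter (Suc k) M = newton_schulz (polar_iter k M)"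
      by (simp add: polar_iter_def)
    then show ?case by (simp add: Suc newton_schulz_sum_outer[OF u v])
  qed
  have "(\<lambda>k. polar_iter k M $ i $ j) \<longlonglongrightarrow> (\<Sum>l<q. outer (u l) (v l)) $ i $ j" for i j
  proof -
    have "(\<lambda>k. \<Sum>l<q. (?f ^^ k) (s l / c) * outer (u l) (v l) $ i $ j)
      \<longlonglongrightarrow> (\<Sum>l<q. 1 * outer (u l) (v l) $ i $ j)"
      using s s_le c
      by (intro tendsto_sum tendsto_mult tendsto_const newton_schulz_scalar_tendsto) auto
    then show ?thesis by (simp add: iter)
  qed
  then show ?thesis by (simp add: polar_def vec_eq_iff limI)
qed

lemma borel_measurable_polar:
  fixes M :: "'w \<Rightarrow> real ^ 'l ^ 'k"
  assumes M: "\<And>i j. (\<lambda>w. M w $ i $ j) \<in> borel_measurable \<Omega>"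
  shows "(\<lambda>w. polar (M w) $ i $ j) \<in> borel_measurable \<Omega>"
proof -
  note [measurable] = M
  have [measurable]: "(\<lambda>w. polar_iter k (M w) $ i $ j) \<in> borel_measurable \<Omega>" for k i j
  proof (induction k arbitrary: i j)
    case 0
    show ?case by (simp add: polar_iter_def) measurable
  next
    case (Suc k)
    note [measurable] = Suc
    have "polar_iter (Suc k) (M w) $ i $ j = 3 / 2 * polar_iter k (M w) $ i $ j
      - 1 / 2 * (\<Sum>l\<in>UNIV. (\<Sum>m\<in>UNIV. polar_iter k (M w) $ i $ m * polar_iter k (M w) $ l $ m)
          * polar_iter k (M w) $ l $ j)" for w
      by (simp add: polar_iter_def newton_schulz_def matrix_matrix_mult_def transpose_def)
    then show ?case by simp
  qed
  show ?thesis by (simp add: polar_def)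
qed

section \<open>Projections and the two assumptions in terms of the polar factor\<close>

lemma orth_proj_span_orthonormal:
  fixes u :: "nat \<Rightarrow> 'a::euclidean_space"
  assumes u: "\<forall>i<q. \<forall>j<q. u i \<bullet> u j = (if i = j then 1 else 0)"
  shows "orth_proj (span (u ` {..<q})) x = (\<Sum>i<q. (u i \<bullet> x) *\<^sub>R u i)"
  unfolding orth_proj_def
proof (rule the_equality)
  let ?U = "span (u ` {..<q})" and ?y = "\<Sum>i<q. (u i \<bullet> x) *\<^sub>R u i"
  have y: "?y \<in> ?U" by (intro span_sum span_scale span_base) auto
  have "orthogonal (x - ?y) z" if "z \<in> ?U" for z
    using that
  proof (rule orthogonal_to_span)
    show "orthogonal (x - ?y) w" if "w \<in> u ` {..<q}" for w
      using that orthonormal_inner_sum[OF u]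
      by (auto simp: orthogonal_def inner_diff_left inner_commute[of _ "u _"])
  qed
  with y show y': "?y \<in> ?U \<and> (\<forall>z\<in>?U. orthogonal (x - ?y) z)" by blast
  fix y assume y2: "y \<in> ?U \<and> (\<forall>z\<in>?U. orthogonal (x - y) z)"
  then have "y - ?y \<in> ?U" using y by (auto intro: span_diff)
  then have "orthogonal (x - ?y) (y - ?y)" "orthogonal (x - y) (y - ?y)"
    using y' y2 by blast+
  then have "(y - ?y) \<bullet> (y - ?y) = 0"
    by (simp add: orthogonal_def inner_diff_left)
  then show "y = ?y" by simp
qed

text \<open>The polar factor \<open>Q\<close> satisfies that \<open>Q Q^T\<close> is the orthogonal
  projection onto the column space, so its squared row norms are the diagonal entries of that
  projection.\<close>

lemma norm_orth_proj_span_columns: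
  fixes M :: "real ^ 'l ^ 'k"
  assumes svd: "compact_svd M q s u v"
  shows "(norm (orth_proj (span (columns M)) (axis i 1)))\<^sup>2 = (\<Sum>l<q. (u l $ i)\<^sup>2)"
    and "(\<Sum>l<q. (u l $ i)\<^sup>2) = (\<Sum>j\<in>UNIV. (polar M $ i $ j)\<^sup>2)"
proof -
  have u: "\<forall>i<q. \<forall>j<q. u i \<bullet> u j = (if i = j then 1 else 0)"
    and v: "\<forall>i<q. \<forall>j<q. v i \<bullet> v j = (if i = j then 1 else 0)"
    using svd unfolding compact_svd_def by blast+
  show "(norm (orth_proj (span (columns M)) (axis i 1)))\<^sup>2 = (\<Sum>l<q. (u l $ i)\<^sup>2)"
    by (simp add: compact_svd_span_columns[OF svd] orth_proj_span_orthonormal[OF u]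
        power2_norm_eq_inner orthonormal_sum_inner_self[OF u] inner_axis)
  have "polar M $ i $ j = (\<Sum>l<q. (u l $ i) *\<^sub>R v l) $ j" for j
    by (simp add: polar_compact_svd[OF svd] outer_def)
  then have "(\<Sum>j\<in>UNIV. (polar M $ i $ j)\<^sup>2) = (\<Sum>l<q. (u l $ i) *\<^sub>R v l) \<bullet> (\<Sum>l<q. (u l $ i) *\<^sub>R v l)"
    by (simp add: inner_vec_def power2_eq_square)
  then show "(\<Sum>l<q. (u l $ i)\<^sup>2) = (\<Sum>j\<in>UNIV. (polar M $ i $ j)\<^sup>2)"
    by (simp add: orthonormal_sum_inner_self[OF v])
qed

text \<open>Row and column space coincide by symmetry, so the maximum of the two coherences
  collapses, and what remains is a function of the entries of \<open>polar M\<close>.\<close>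

lemma A0_symmetric_iff:
  fixes M :: "real ^ 'n ^ 'n"
  assumes M: "transpose M = M"
  shows "A0 r mu0 M \<longleftrightarrow>
    real CARD('n) / real r * (MAX i. \<Sum>j\<in>UNIV. (polar M $ i $ j)\<^sup>2) \<le> mu0"
proof -
  obtain q s u v where svd: "compact_svd M q s u v"
    using symmetric_matrix_ex_compact_svd[OF M] .
  have "rows M = columns M" using columns_transpose[of M] M by simp
  then show ?thesis
    unfolding A0_def coherence_def by (simp only: norm_orth_proj_span_columns[OF svd] max.idem)
qed

lemma A1_symmetric_iff:
  fixes M :: "real ^ 'n ^ 'n"
  assumes M: "transpose M = M"
  shows "A1 r mu1 M \<longleftrightarrow>
    (\<forall>i j. \<bar>polar M $ i $ j\<bar> \<le> mu1 * sqrt (real r / (real CARD('n) * real CARD('n))))"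
proof -
  have set: "{\<bar>W $ i $ j\<bar> |i j. True} = (\<lambda>(i, j). \<bar>W $ i $ j\<bar>) ` UNIV" for W :: "real ^ 'n ^ 'n"
    by auto
  have max: "max_entry W \<le> B \<longleftrightarrow> (\<forall>i j. \<bar>W $ i $ j\<bar> \<le> B)" for W :: "real ^ 'n ^ 'n" and B
    unfolding max_entry_def set by (subst Max_le_iff) auto
  obtain q s u v where svd: "compact_svd M q s u v"
    using symmetric_matrix_ex_compact_svd[OF M] .
  have "A1 r mu1 M \<longleftrightarrow> max_entry (polar M) \<le> mu1 * sqrt (real r / (real CARD('n) * real CARD('n)))"
    unfolding A1_def
  proof (intro iffI allI impI)
    assume "\<forall>q s u v. compact_svd M q s u v \<longrightarrow> max_entry (\<Sum>i<q. outer (u i) (v i))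
      \<le> mu1 * sqrt (real r / (real CARD('n) * real CARD('n)))"
    then show "max_entry (polar M) \<le> mu1 * sqrt (real r / (real CARD('n) * real CARD('n)))"
      using svd by (simp add: polar_compact_svd[OF svd])
  next
    fix q s u v
    assume "max_entry (polar M) \<le> mu1 * sqrt (real r / (real CARD('n) * real CARD('n)))"
      and svd': "compact_svd M q s u v"
    then show "max_entry (\<Sum>i<q. outer (u i) (v i))
      \<le> mu1 * sqrt (real r / (real CARD('n) * real CARD('n)))"
      by (simp add: polar_compact_svd[OF svd'])
  qed
  then show ?thesis by (simp add: max)
qed

section \<open>Moments and the cubic\<close>

lemma atomless_emeasure_singleton:
  assumes P: "atomless P" and x: "{x} \<in> sets P"
  shows "emeasure P {x} = 0"
proof (rule ccontr)
  assume "emeasure P {x} \<noteq> 0"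
  then obtain B where "B \<subseteq> {x}" "0 < emeasure P B" "emeasure P B < emeasure P {x}"
    using P x by (auto simp: atomless_def zero_less_iff_neq_zero)
  then show False by (auto simp: subset_singleton_iff)
qed

text \<open>Used for the root set of a nonzero polynomial, on which an atomless law cannot be
  concentrated.\<close>

lemma atomless_not_AE_finite:
  fixes P :: "real measure"
  assumes P: "atomless P" "prob_space P" "sets P = sets borel" and F: "finite F"
  shows "\<not> (AE s in P. s \<in> F)"
proof
  assume AE: "AE s in P. s \<in> F"
  interpret prob_space P by fact
  have [measurable_cong]: "sets P = sets borel" by fact
  have "AE s in P. s \<noteq> x" for x
  proof (rule AE_I)
    show "{s \<in> space P. \<not> s \<noteq> x} \<subseteq> {x}" by auto
    show x: "{x} \<in> events" by (simp add: P(3))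
    show "emeasure P {x} = 0" by (rule atomless_emeasure_singleton[OF P(1) x])
  qed
  then have "AE s in P. \<forall>x\<in>F. s \<noteq> x" using F by (simp add: AE_ball_countable countable_finite)
  with AE have "AE s in P. False" by eventually_elim auto
  then show False by simp
qed

text \<open>For \<open>m 1 = 0\<close> the second quantity is the Gram determinant of 1, s, s^2 in
  L^2(P).\<close>

lemma atomless_moment_bounds:
  fixes P :: "real measure"
  assumes P: "atomless P" "prob_space P" "sets P = sets borel"
    and int: "\<And>k. integrable P (\<lambda>s. s ^ k)"
    and m: "\<And>k. m k = (\<integral>s. s ^ k \<partial>P)" and m1: "m 1 = 0"
  shows "0 < m 2" "0 < m 4 * m 2 - m 2 ^ 3 - m 3 ^ 2"
proof -
  interpret prob_space P by fact
  have pos: "0 < (\<integral>s. (poly p s)\<^sup>2 \<partial>P)"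
    if p: "p \<noteq> 0" and int: "integrable P (\<lambda>s. (poly p s)\<^sup>2)" for p :: "real poly"
  proof -
    have "(\<integral>s. (poly p s)\<^sup>2 \<partial>P) \<noteq> 0"
    proof
      assume "(\<integral>s. (poly p s)\<^sup>2 \<partial>P) = 0"
      then have "AE s in P. (poly p s)\<^sup>2 = 0"
        using integral_nonneg_eq_0_iff_AE[OF int] by simp
      then have "AE s in P. s \<in> {s. poly p s = 0}" by simp
      then show False using atomless_not_AE_finite[OF P poly_roots_finite[OF p]] by simp
    qed
    moreover have "0 \<le> (\<integral>s. (poly p s)\<^sup>2 \<partial>P)" by simp
    ultimately show ?thesis by linarith
  qed
  show m2: "0 < m 2"
    using pos[of "[:0, 1:]"] int[of 2] by (simp add: m)
  \<comment> \<open>This is \<open>m 2\<close> times the residual of s^2 after projection onto the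
    span of 1 and s; its squared norm is \<open>m 2\<close> times the Gram determinant.\<close>
  let ?p = "[:- (m 2)\<^sup>2, - m 3, m 2:]"
  have sq: "(poly ?p s)\<^sup>2 = (m 2)\<^sup>2 * s ^ 4 - 2 * m 2 * m 3 * s ^ 3
      + ((m 3)\<^sup>2 - 2 * m 2 ^ 3) * s ^ 2 + 2 * m 3 * (m 2)\<^sup>2 * s ^ 1 + m 2 ^ 4 * s ^ 0" for s
    by (simp add: power2_eq_square power3_eq_cube power4_eq_xxxx algebra_simps)
  have int_p: "integrable P (\<lambda>s. (poly ?p s)\<^sup>2)"
    unfolding sq by (intro Bochner_Integration.integrable_add Bochner_Integration.integrable_diff integrable_mult_right int)
  have "(\<integral>s. (poly ?p s)\<^sup>2 \<partial>P) = (m 2)\<^sup>2 * m 4 - 2 * m 2 * m 3 * m 3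
      + ((m 3)\<^sup>2 - 2 * m 2 ^ 3) * m 2 + 2 * m 3 * (m 2)\<^sup>2 * m 1 + m 2 ^ 4 * m 0"
    unfolding sq using int
    by (simp only: m[symmetric] Bochner_Integration.integral_add Bochner_Integration.integral_diff
        integral_mult_right_zero Bochner_Integration.integrable_add
        Bochner_Integration.integrable_diff integrable_mult_right)
  also have "\<dots> = m 2 * (m 4 * m 2 - m 2 ^ 3 - m 3 ^ 2)"
    using m1 m[of 0] prob_space by (simp add: power2_eq_square power3_eq_cube power4_eq_xxxx algebra_simps)
  finally show "0 < m 4 * m 2 - m 2 ^ 3 - m 3 ^ 2"
    using pos[OF _ int_p] m2 by (simp add: zero_less_mult_iff)
qed


lemma Im_of_real_divide_of_real_minus:
  "Im (complex_of_real g / (complex_of_real r - z)) = g * Im z / (cmod (complex_of_real r - z))\<^sup>2"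
  by (simp add: Im_divide cmod_power2)

text \<open>The cubic is \<open>x \<mapsto> det (B - x)\<close> for the symmetric matrix
  \<open>B = [[1, 0, d m\<^sub>2], [0, m\<^sub>2, sqrt d m\<^sub>3], [d m\<^sub>2, sqrt d m\<^sub>3, d m\<^sub>4 + d (d - 1) m\<^sub>2\<^sup>2]]\<close>.\<close>

locale moment_cubic =
  fixes m2 m3 m4 d \<alpha>0 \<alpha>1 \<alpha>2 :: real
  assumes d: "1 \<le> d" and m2: "0 < m2" and gram: "0 < m4 * m2 - m2 ^ 3 - m3 ^ 2"
    and \<alpha>0: "\<alpha>0 = (m4 * m2 - m2 ^ 3 - m3 ^ 2) * d"
    and \<alpha>1: "\<alpha>1 = - (m2 ^ 3) * d ^ 2
                 + (m2 ^ 3 + m3 ^ 2 + m2 ^ 2 - m4 - m4 * m2) * d - m2"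
    and \<alpha>2: "\<alpha>2 = m2 ^ 2 * d ^ 2 + (m4 - m2 ^ 2) * d + m2 + 1"
begin

text \<open>The expectation of the fourth power of the length of a point: \<open>d\<close> diagonal
  terms and \<open>d * (d - 1)\<close> products of independent squares.\<close>

definition q :: real where "q = d * m4 + d * (d - 1) * m2\<^sup>2"

definition f :: "real \<Rightarrow> real" where "f x = \<alpha>0 + \<alpha>1 * x + \<alpha>2 * x\<^sup>2 - x ^ 3"

lemma f_det: "f x = (1 - x) * (m2 - x) * (q - x) - (d * m2)\<^sup>2 * (m2 - x) - d * m3\<^sup>2 * (1 - x)"
  unfolding f_def unfolding \<alpha>0 \<alpha>1 \<alpha>2 q_def
  by (simp add: power2_eq_square power3_eq_cube algebra_simps)

lemma m4_ge: "m2\<^sup>2 < m4"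
proof -
  have "m2 ^ 3 < m4 * m2" using gram zero_le_power2[of m3] by linarith
  then have "m2\<^sup>2 * m2 < m4 * m2" by (simp add: power2_eq_square power3_eq_cube)
  then show ?thesis using m2 by simp
qed

text \<open>The alternating signs keep \<open>f\<close> positive on the nonpositive
  half-line.\<close>

lemma coeff_signs: "0 < \<alpha>0" "\<alpha>1 < 0" "0 < \<alpha>2"
proof -
  show "0 < \<alpha>0" using gram d by (simp add: \<alpha>0)
  have "- \<alpha>1 = m2 + d * (m4 - m2\<^sup>2) + d * (m4 * m2 - m2 ^ 3 - m3 ^ 2) + d\<^sup>2 * m2 ^ 3"
    by (simp add: \<alpha>1 algebra_simps)
  moreover have "0 \<le> d * (m4 - m2\<^sup>2)" "0 \<le> d * (m4 * m2 - m2 ^ 3 - m3 ^ 2)" "0 \<le> d\<^sup>2 * m2 ^ 3"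
    using d gram m2 m4_ge by simp_all
  ultimately show "\<alpha>1 < 0" using m2 by linarith
  have "0 \<le> (m4 - m2\<^sup>2) * d" "0 \<le> m2\<^sup>2 * d\<^sup>2" using d m4_ge by simp_all
  then show "0 < \<alpha>2" using m2 unfolding \<alpha>2 by linarith
qed

lemma f_pos: "x \<le> 0 \<Longrightarrow> 0 < f x"
proof -
  assume x: "x \<le> 0"
  have "0 \<le> \<alpha>1 * x" using coeff_signs(2) x by (simp add: mult_nonpos_nonpos)
  moreover have "0 \<le> \<alpha>2 * x\<^sup>2" using coeff_signs(3) by simp
  moreover have "x ^ 3 \<le> 0" using x by (simp add: power3_eq_cube mult_nonneg_nonpos mult_nonpos_nonpos)
  ultimately show ?thesis using coeff_signs(1) unfolding f_def by linarith
qed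

lemma f_pos_below_roots:
  assumes "\<And>x. f x = 0 \<Longrightarrow> y < x"
  shows "0 < f y"
proof (rule ccontr)
  assume neg: "\<not> 0 < f y"
  then have y: "0 \<le> y" using f_pos[of y] by (cases "y \<le> 0") auto
  have "\<exists>x. 0 \<le> x \<and> x \<le> y \<and> f x = 0"
    using neg f_pos[of 0] y by (intro IVT2') (auto simp: f_def intro!: continuous_intros)
  then show False using assms by force
qed

text \<open>For non-real \<open>z\<close>, dividing the determinant by
  \<open>(1 - z) * (m2 - z)\<close> writes \<open>q - z\<close> as a nonnegative combination of
  \<open>1 / (1 - z)\<close> and \<open>1 / (m2 - z)\<close>. Both have imaginary part of the sign
  of \<open>Im z\<close>, whereas \<open>q - z\<close> has the opposite one.\<close>

lemma complex_root:
  assumes z: "complex_of_real \<alpha>0 + complex_of_real \<alpha>1 * z + complex_of_real \<alpha>2 * z\<^sup>2 - z ^ 3 = 0"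
  shows "z \<in> \<real> \<and> 0 < Re z \<and> f (Re z) = 0"
proof -
  have "Im z = 0"
  proof (rule ccontr)
    assume Im: "Im z \<noteq> 0"
    let ?r = complex_of_real
    have ne: "?r 1 - z \<noteq> 0" "?r m2 - z \<noteq> 0"
      using Im by (auto simp: complex_eq_iff)
    have "(?r 1 - z) * (?r m2 - z) * (?r q - z) - ?r ((d * m2)\<^sup>2) * (?r m2 - z) - ?r (d * m3\<^sup>2) * (?r 1 - z) = 0"
      unfolding z[symmetric] \<alpha>0 \<alpha>1 \<alpha>2 q_def
      by (simp add: power2_eq_square power3_eq_cube algebra_simps)
    moreover have "c = g / a + h / b" if "a * b * c - g * b - h * a = 0" "a \<noteq> 0" "b \<noteq> 0"
      for a b c g h :: complex
      using that by (simp add: field_simps)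
    ultimately have "?r q - z = ?r ((d * m2)\<^sup>2) / (?r 1 - z) + ?r (d * m3\<^sup>2) / (?r m2 - z)"
      using ne by blast
    then have "Im (?r q - z) = Im (?r ((d * m2)\<^sup>2) / (?r 1 - z)) + Im (?r (d * m3\<^sup>2) / (?r m2 - z))"
      by (metis plus_complex.simps(2))
    then have "- Im z = (d * m2)\<^sup>2 * Im z / (cmod (?r 1 - z))\<^sup>2 + d * m3\<^sup>2 * Im z / (cmod (?r m2 - z))\<^sup>2"
      unfolding Im_of_real_divide_of_real_minus by simp
    then have "Im z * (1 + (d * m2)\<^sup>2 / (cmod (?r 1 - z))\<^sup>2 + d * m3\<^sup>2 / (cmod (?r m2 - z))\<^sup>2) = 0"
      by (simp add: algebra_simps)
    then have "1 + (d * m2)\<^sup>2 / (cmod (?r 1 - z))\<^sup>2 + d * m3\<^sup>2 / (cmod (?r m2 - z))\<^sup>2 = 0"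
      using Im mult_eq_0_iff by blast
    moreover have "0 \<le> (d * m2)\<^sup>2 / (cmod (?r 1 - z))\<^sup>2" "0 \<le> d * m3\<^sup>2 / (cmod (?r m2 - z))\<^sup>2"
      using d by simp_all
    ultimately show False by linarith
  qed
  then have zr: "z = complex_of_real (Re z)" by (simp add: complex_eq_iff)
  have "complex_of_real (f (Re z)) = 0"
    using z by (subst (asm) (1 2 3) zr) (simp add: f_def)
  then have "f (Re z) = 0" by simp
  moreover have "0 < Re z" using f_pos[of "Re z"] calculation by force
  ultimately show ?thesis using zr by (metis Reals_of_real)
qed

text \<open>This is the form of the second-moment matrix minus \<mu>, where \<open>y2\<close> stands
  for \<open>y \<bullet> y\<close> and \<open>Y\<close> for the sum of the coordinates of
  \<open>y\<close>. The hypothesis on \<open>Y\<close> is Cauchy-Schwarz.\<close>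

lemma quadratic_form_nonneg:
  assumes below: "\<And>x. f x = 0 \<Longrightarrow> \<mu> < x" and \<mu>: "\<mu> < m2" and Y: "Y\<^sup>2 \<le> d * y2"
  shows "0 \<le> (1 - \<mu>) * z0\<^sup>2 + (m2 - \<mu>) * y2 + (q - \<mu>) * z1\<^sup>2 + 2 * (d * m2) * z0 * z1 + 2 * m3 * z1 * Y"
proof -
  have f\<mu>: "0 < f \<mu>" using below by (rule f_pos_below_roots)
  \<comment> \<open>Otherwise 1 also lies below all roots, so \<open>f 1 > 0\<close>; but
    \<open>f 1 = - (d * m2)^2 * (m2 - 1)\<close>, which is nonpositive because
    \<open>m2 > \<mu> \<ge> 1\<close>.\<close>
  have "\<mu> < 1"
  proof (rule ccontr)
    assume "\<not> \<mu> < 1"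
    then have "0 < f 1" using below by (intro f_pos_below_roots) force
    moreover have "0 \<le> (d * m2)\<^sup>2 * (m2 - 1)" using \<open>\<not> \<mu> < 1\<close> \<mu> by simp
    ultimately show False by (simp add: f_det)
  qed
  define A B C where "A = 1 - \<mu>" and "B = m2 - \<mu>" and "C = q - \<mu>"
  let ?F = "A * z0\<^sup>2 + B * y2 + C * z1\<^sup>2 + 2 * (d * m2) * z0 * z1 + 2 * m3 * z1 * Y"
  have A: "0 < A" and B: "0 < B" using \<open>\<mu> < 1\<close> \<mu> by (simp_all add: A_def B_def)
  have f: "f \<mu> = A * B * C - (d * m2)\<^sup>2 * B - d * m3\<^sup>2 * A"
    by (simp add: f_det A_def B_def C_def)
  \<comment> \<open>Completing the squares in \<open>z0\<close> and \<open>Y\<close>. The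
    coefficient left for \<open>z1^2\<close> is the determinant \<open>f \<mu>\<close>, up to the
    factor \<open>d\<close>.\<close>
  have "d * (A * B) * ?F = d * B * (A * z0 + d * m2 * z1)\<^sup>2 + A * (B * Y + d * m3 * z1)\<^sup>2
      + A * B\<^sup>2 * (d * y2 - Y\<^sup>2) + d * z1\<^sup>2 * f \<mu>"
    unfolding f by (simp add: power2_eq_square algebra_simps)
  moreover have "0 \<le> d * B * (A * z0 + d * m2 * z1)\<^sup>2" "0 \<le> A * (B * Y + d * m3 * z1)\<^sup>2"
    "0 \<le> A * B\<^sup>2 * (d * y2 - Y\<^sup>2)" "0 \<le> d * z1\<^sup>2 * f \<mu>"
    using d A B Y f\<mu> by simp_all
  ultimately have "0 \<le> d * (A * B) * ?F" by linarith
  moreover have "0 < d * (A * B)" using d A B by simp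
  ultimately show ?thesis
    unfolding A_def[symmetric] B_def[symmetric] C_def[symmetric] by (simp add: zero_le_mult_iff)
qed

end

section \<open>Euclidean distance matrices\<close>

text \<open>The projection of the \<open>k\<close>-th basis vector lies in the range of
  \<open>M\<close>; its \<open>k\<close>-th entry and its squared norm are both the leverage
  \<open>?S\<close>. The hypothesis therefore reads \<open>?S^2 \<le> \<rho> * ?S\<close>.\<close>

lemma svd_leverage_le:
  fixes M :: "real ^ 'l ^ 'k"
  assumes svd: "compact_svd M q s u v" and \<rho>: "0 \<le> \<rho>"
    and le: "\<And>x. ((M *v x) $ k)\<^sup>2 \<le> \<rho> * ((M *v x) \<bullet> (M *v x))"
  shows "(\<Sum>l<q. (u l $ k)\<^sup>2) \<le> \<rho>"
proof -
  have u: "\<forall>i<q. \<forall>j<q. u i \<bullet> u j = (if i = j then 1 else 0)"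
    using svd unfolding compact_svd_def by blast
  let ?y = "\<Sum>l<q. (u l $ k) *\<^sub>R u l" and ?S = "\<Sum>l<q. (u l $ k)\<^sup>2"
  have "?y \<in> span (u ` {..<q})" by (intro span_sum span_scale span_base) auto
  then have "?y \<in> range ((*v) M)"
    unfolding compact_svd_span_columns[OF svd, symmetric] span_columns_eq_range .
  then obtain x where "?y = M *v x" by blast
  then have "(?y $ k)\<^sup>2 \<le> \<rho> * (?y \<bullet> ?y)" using le[of x] by simp
  moreover have "?y $ k = ?S" by (simp add: power2_eq_square)
  moreover have "?y \<bullet> ?y = ?S" by (rule orthonormal_sum_inner_self[OF u])
  ultimately have "?S * ?S \<le> \<rho> * ?S" by (simp add: power2_eq_square)
  moreover have "0 \<le> ?S" by (simp add: sum_nonneg)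
  ultimately show ?thesis using \<rho> by (cases "?S = 0") auto
qed

text \<open>Row norms are leverages. A single entry pairs a row of left with a row of right singular
  vectors, so Cauchy-Schwarz bounds it by two leverages.\<close>

lemma polar_symmetric_entries_le:
  fixes M :: "real ^ 'n ^ 'n"
  assumes M: "transpose M = M" and \<rho>: "0 \<le> \<rho>"
    and le: "\<And>x k. ((M *v x) $ k)\<^sup>2 \<le> \<rho> * ((M *v x) \<bullet> (M *v x))"
  shows "(\<Sum>j\<in>UNIV. (polar M $ i $ j)\<^sup>2) \<le> \<rho>" "\<bar>polar M $ i $ j\<bar> \<le> \<rho>"
proof -
  obtain q s u v where svd: "compact_svd M q s u v"
    using symmetric_matrix_ex_compact_svd[OF M] .
  have svd': "compact_svd M q s v u" using compact_svd_transpose[OF svd] M by simp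
  have u: "(\<Sum>l<q. (u l $ i)\<^sup>2) \<le> \<rho>" for i by (rule svd_leverage_le[OF svd \<rho> le])
  have v: "(\<Sum>l<q. (v l $ i)\<^sup>2) \<le> \<rho>" for i by (rule svd_leverage_le[OF svd' \<rho> le])
  show "(\<Sum>j\<in>UNIV. (polar M $ i $ j)\<^sup>2) \<le> \<rho>"
    using u[of i] norm_orth_proj_span_columns(2)[OF svd, of i] by simp
  have "polar M $ i $ j = (\<Sum>l<q. u l $ i * v l $ j)"
    by (simp add: polar_compact_svd[OF svd] outer_def)
  then have "(polar M $ i $ j)\<^sup>2 \<le> (\<Sum>l<q. (u l $ i)\<^sup>2) * (\<Sum>l<q. (v l $ j)\<^sup>2)"
    using Cauchy_Schwarz_ineq_sum[of "\<lambda>l. u l $ i" "\<lambda>l. v l $ j" "{..<q}"] by simp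
  also have "\<dots> \<le> \<rho> * \<rho>" using u v \<rho> by (intro mult_mono sum_nonneg) auto
  finally have "\<bar>polar M $ i $ j\<bar>\<^sup>2 \<le> \<rho>\<^sup>2" by (simp add: power2_eq_square)
  then show "\<bar>polar M $ i $ j\<bar> \<le> \<rho>" using \<rho> by (rule power2_le_imp_le)
qed

definition feature :: "real ^ 'd \<Rightarrow> real \<times> (real ^ 'd) \<times> real" where
  "feature p = (1, p, (norm p)\<^sup>2)"

lemma transpose_edm: "transpose (edm p) = edm p"
  by (simp add: edm_def transpose_def vec_eq_iff norm_minus_commute)

text \<open>The right-hand vector is \<open>S X^T x\<close> in the factorisation
  \<open>X S X^T\<close>; it does not depend on \<open>k\<close>.\<close>

lemma edm_mult_vec:
  "(edm p *v x) $ k = feature (p k) \<bullet>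
    (\<Sum>j\<in>UNIV. (norm (p j))\<^sup>2 * x $ j, - 2 *\<^sub>R (\<Sum>j\<in>UNIV. x $ j *\<^sub>R p j), \<Sum>j\<in>UNIV. x $ j)"
proof -
  have "(norm (p k - p j))\<^sup>2 * x $ j
    = (norm (p j))\<^sup>2 * x $ j + - 2 * (x $ j * (p k \<bullet> p j)) + (norm (p k))\<^sup>2 * x $ j" for j
    by (simp add: power2_norm_eq_inner inner_diff_left inner_diff_right inner_commute[of "p j" "p k"] algebra_simps)
  then have "(edm p *v x) $ k
    = (\<Sum>j\<in>UNIV. (norm (p j))\<^sup>2 * x $ j + - 2 * (x $ j * (p k \<bullet> p j)) + (norm (p k))\<^sup>2 * x $ j)"
    by (simp add: edm_def matrix_vector_mult_def)
  then show ?thesis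
    by (simp add: feature_def sum.distrib sum_subtractf sum_distrib_left inner_sum_right)
qed

text \<open>An image vector has the form \<open>X z\<close>. A single entry is at most
  \<open>sqrt R\<close> times the norm of \<open>z\<close>, which the lower bound on
  \<open>X^T X\<close> controls by the norm of \<open>X z\<close>.\<close>

lemma edm_row_le:
  assumes \<tau>: "0 < \<tau>" and R: "\<And>i. feature (p i) \<bullet> feature (p i) \<le> R"
    and good: "\<And>z. \<tau> * (z \<bullet> z) \<le> (\<Sum>i\<in>UNIV. (feature (p i) \<bullet> z)\<^sup>2)"
  shows "((edm p *v x) $ k)\<^sup>2 \<le> R / \<tau> * ((edm p *v x) \<bullet> (edm p *v x))"
proof -
  obtain z where z: "\<And>k. (edm p *v x) $ k = feature (p k) \<bullet> z"
    using edm_mult_vec[of p x] by blast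
  have R0: "0 \<le> R" using R[of k] inner_ge_zero[of "feature (p k)"] by linarith
  have "((edm p *v x) $ k)\<^sup>2 \<le> R * (z \<bullet> z)" unfolding z by (rule inner_sq_le[OF R])
  also have "\<dots> = R / \<tau> * (\<tau> * (z \<bullet> z))" using \<tau> by simp
  also have "\<dots> \<le> R / \<tau> * (\<Sum>i\<in>UNIV. (feature (p i) \<bullet> z)\<^sup>2)"
    using R0 \<tau> by (intro mult_left_mono good) auto
  also have "(\<Sum>i\<in>UNIV. (feature (p i) \<bullet> z)\<^sup>2) = (edm p *v x) \<bullet> (edm p *v x)"
    by (simp add: inner_vec_def z power2_eq_square)
  finally show ?thesis .
qed

lemma inner_feature_self_le:
  fixes p :: "real ^ 'd"
  assumes "\<And>j. \<bar>p $ j\<bar> \<le> c"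
  shows "feature p \<bullet> feature p \<le> 1 + real CARD('d) * c\<^sup>2 + (real CARD('d))\<^sup>2 * c ^ 4"
proof -
  have "p \<bullet> p = (\<Sum>j\<in>UNIV. (p $ j)\<^sup>2)" by (simp add: inner_vec_def power2_eq_square)
  also have "\<dots> \<le> (\<Sum>j\<in>(UNIV::'d set). c\<^sup>2)"
    using assms by (intro sum_mono) (metis abs_ge_zero power2_abs power_mono)
  finally have le: "p \<bullet> p \<le> real CARD('d) * c\<^sup>2" by simp
  then have "(p \<bullet> p) * (p \<bullet> p) \<le> (real CARD('d) * c\<^sup>2) * (real CARD('d) * c\<^sup>2)"
    by (intro mult_mono) auto
  moreover have "feature p \<bullet> feature p = 1 + p \<bullet> p + (p \<bullet> p) * (p \<bullet> p)"
    by (simp add: feature_def power2_norm_eq_inner)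
  moreover have "(real CARD('d) * c\<^sup>2) * (real CARD('d) * c\<^sup>2) = (real CARD('d))\<^sup>2 * c ^ 4"
    by (simp add: power2_eq_square power4_eq_xxxx)
  ultimately show ?thesis using le by linarith
qed

section \<open>Moments, independence and measurability for the features\<close>

lemma (in prob_space) centred_sum_second_moment:
  fixes C :: "'i::finite \<Rightarrow> 'a \<Rightarrow> real"
  assumes int: "\<And>i. integrable M (C i)" "\<And>i j. integrable M (\<lambda>w. C i w * C j w)"
    and mean: "\<And>i. expectation (C i) = 0"
    and uncor: "\<And>i j. i \<noteq> j \<Longrightarrow> expectation (\<lambda>w. C i w * C j w) = 0"
  shows "expectation (\<lambda>w. (K + (\<Sum>i\<in>UNIV. C i w))\<^sup>2) = K\<^sup>2 + (\<Sum>i\<in>UNIV. expectation (\<lambda>w. C i w * C i w))"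
proof -
  have "(K + (\<Sum>i\<in>UNIV. C i w))\<^sup>2
    = K\<^sup>2 + (2 * K * (\<Sum>i\<in>UNIV. C i w) + (\<Sum>i\<in>UNIV. \<Sum>j\<in>UNIV. C i w * C j w))" for w
    unfolding sum_product[symmetric] by (simp add: power2_eq_square algebra_simps)
  then have "expectation (\<lambda>w. (K + (\<Sum>i\<in>UNIV. C i w))\<^sup>2)
    = K\<^sup>2 + (2 * K * (\<Sum>i\<in>UNIV. expectation (C i)) + (\<Sum>i\<in>UNIV. \<Sum>j\<in>UNIV. expectation (\<lambda>w. C i w * C j w)))"
    using int by (simp add: Bochner_Integration.integral_sum prob_space)
  also have "(\<Sum>i\<in>UNIV. \<Sum>j\<in>UNIV. expectation (\<lambda>w. C i w * C j w))
    = (\<Sum>i\<in>UNIV. \<Sum>j\<in>UNIV. if i = j then expectation (\<lambda>w. C i w * C i w) else 0)"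
    using uncor by (intro sum.cong refl) auto
  finally show ?thesis by (simp add: mean)
qed

lemma (in prob_space) feature_second_moment:
  fixes x :: "'d::finite \<Rightarrow> 'a \<Rightarrow> real" and y :: "real ^ 'd"
  assumes ind: "\<And>j k. j \<noteq> k \<Longrightarrow> indep_var borel (x j) borel (x k)"
    and int: "\<And>j k. integrable M (\<lambda>w. x j w ^ k)"
    and m: "\<And>j k. expectation (\<lambda>w. x j w ^ k) = m k" and m1: "m 1 = 0"
  shows "expectation (\<lambda>w. (feature (\<chi> j. x j w) \<bullet> (z0, y, z1))\<^sup>2)
    = z0\<^sup>2 + m 2 * (y \<bullet> y) + (real CARD('d) * m 4 + real CARD('d) * (real CARD('d) - 1) * (m 2)\<^sup>2) * z1\<^sup>2
      + 2 * (real CARD('d) * m 2) * z0 * z1 + 2 * m 3 * z1 * (\<Sum>j\<in>UNIV. y $ j)"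
proof -
  let ?d = "real CARD('d)"
  \<comment> \<open>Removing the mean \<open>z1 * m 2\<close> of the quadratic part centres each
    coordinate's contribution. Distinct contributions are independent, so all cross terms
    vanish.\<close>
  define C where "C j w = y $ j * x j w + z1 * ((x j w)\<^sup>2 - m 2)" for j w
  have m0: "m 0 = 1" using m[of _ 0] prob_space by simp
  have int1: "integrable M (x j)" and m1': "expectation (x j) = 0" for j
    using int[of j 1] m[of j 1] m1 by simp_all
  have intC: "integrable M (C j)" for j
    unfolding C_def using int int1 by (intro Bochner_Integration.integrable_add
        Bochner_Integration.integrable_diff integrable_mult_right) auto
  have meanC: "expectation (C j) = 0" for j
    unfolding C_def using int[of j 2] int1[of j] m[of j 2] by (simp add: m1' prob_space)
  have CC: "C j w * C j w = z1\<^sup>2 * x j w ^ 4 + 2 * (y $ j) * z1 * x j w ^ 3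
      + ((y $ j)\<^sup>2 - 2 * z1\<^sup>2 * m 2) * x j w ^ 2 + (- 2 * (y $ j) * z1 * m 2) * x j w ^ 1 + (z1\<^sup>2 * (m 2)\<^sup>2) * x j w ^ 0" for j w
    by (simp add: C_def power2_eq_square power3_eq_cube power4_eq_xxxx algebra_simps)
  have indC: "indep_var borel (C j) borel (C k)" if "j \<noteq> k" for j k
    using indep_var_compose[OF ind[OF that], of "\<lambda>s. y $ j * s + z1 * (s\<^sup>2 - m 2)" borel
        "\<lambda>s. y $ k * s + z1 * (s\<^sup>2 - m 2)" borel]
    by (simp add: comp_def C_def[abs_def])
  have intCC: "integrable M (\<lambda>w. C j w * C k w)" for j k
  proof (cases "j = k")
    case True
    then show ?thesis
      unfolding True CC by (intro Bochner_Integration.integrable_add integrable_mult_right int)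
  qed (intro indep_var_integrable indC intC)
  have CC_exp: "expectation (\<lambda>w. C j w * C j w) = (y $ j)\<^sup>2 * m 2 + 2 * (y $ j) * z1 * m 3 + z1\<^sup>2 * (m 4 - (m 2)\<^sup>2)" for j
    unfolding CC using m1
    by (simp only: m int Bochner_Integration.integral_add integral_mult_right_zero
        Bochner_Integration.integrable_add integrable_mult_right m0)
      (simp add: power2_eq_square algebra_simps)
  have eq: "feature (\<chi> j. x j w) \<bullet> (z0, y, z1) = (z0 + ?d * z1 * m 2) + (\<Sum>j\<in>UNIV. C j w)" for w
  proof -
    have n: "(norm (\<chi> j. x j w))\<^sup>2 = (\<Sum>j\<in>UNIV. (x j w)\<^sup>2)"
      unfolding power2_norm_eq_inner inner_vec_def by (simp add: power2_eq_square)
    show ?thesis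
      by (simp add: feature_def n inner_vec_def C_def sum.distrib
          sum_distrib_left right_diff_distrib sum_subtractf mult_ac)
  qed
  have "expectation (\<lambda>w. (feature (\<chi> j. x j w) \<bullet> (z0, y, z1))\<^sup>2)
    = (z0 + ?d * z1 * m 2)\<^sup>2 + (\<Sum>j\<in>UNIV. expectation (\<lambda>w. C j w * C j w))"
    unfolding eq
  proof (rule centred_sum_second_moment[OF intC intCC meanC])
    show "expectation (\<lambda>w. C i w * C j w) = 0" if "i \<noteq> j" for i j
      using indep_var_lebesgue_integral[OF indC[OF that] intC intC] by (simp add: meanC)
  qed
  also have "(\<Sum>j\<in>UNIV. expectation (\<lambda>w. C j w * C j w))
    = m 2 * (y \<bullet> y) + 2 * z1 * m 3 * (\<Sum>j\<in>UNIV. y $ j) + ?d * (z1\<^sup>2 * (m 4 - (m 2)\<^sup>2))"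
    unfolding CC_exp sum.distrib inner_vec_def sum_distrib_right[symmetric] sum_distrib_left[symmetric]
    by (simp add: power2_eq_square mult_ac)
  finally show ?thesis by (simp add: power2_eq_square algebra_simps)
qed

text \<open>Needed because \<open>quadratic_form_nonneg\<close> requires \<mu> strictly below the
  roots, while the bound is wanted at their minimum.\<close>

lemma le_if_all_smaller_multiples_le:
  fixes S E \<kappa> :: real
  assumes "0 \<le> S" and le: "\<And>\<mu>. \<mu> < \<kappa> \<Longrightarrow> \<mu> * S \<le> E"
  shows "\<kappa> * S \<le> E"
proof (cases "S = 0")
  case True
  then show ?thesis using le[of "\<kappa> - 1"] by simp
next
  case False
  with assms(1) have S: "0 < S" by simp
  have "\<mu> \<le> E / S" if "\<mu> < \<kappa>" for \<mu> using le[OF that] S by (simp add: le_divide_eq)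
  then have "\<kappa> \<le> E / S" by (rule dense_le)
  then show ?thesis using S by (simp add: le_divide_eq)
qed

text \<open>Different points use disjoint blocks of the independent array of coordinates.\<close>

lemma (in prob_space) indep_vars_feature:
  fixes x :: "'n::finite \<Rightarrow> 'd::finite \<Rightarrow> 'a \<Rightarrow> real"
  assumes indep: "indep_vars (\<lambda>_. borel) (\<lambda>(i, j). x i j) UNIV"
  shows "indep_vars (\<lambda>_. borel) (\<lambda>i w. feature (\<chi> j. x i j w)) UNIV"
proof -
  let ?Y = "\<lambda>i v. feature ((\<chi> j. v (i, j)) :: real ^ 'd)"
  have "indep_vars (\<lambda>i. PiM ({i} \<times> UNIV) (\<lambda>_. borel))
      (\<lambda>i w. restrict (\<lambda>k. (\<lambda>(i, j). x i j) k w) ({i} \<times> UNIV)) UNIV"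
    by (rule indep_vars_restrict[OF indep]) (auto simp: disjoint_family_on_def)
  moreover have "?Y i \<in> borel_measurable (PiM ({i} \<times> UNIV) (\<lambda>_. borel))" for i
  proof -
    have [measurable]: "(\<lambda>v. (\<chi> j. v (i, j)) :: real ^ 'd) \<in> borel_measurable (PiM ({i} \<times> UNIV) (\<lambda>_. borel))"
      by (subst borel_measurable_euclidean_space) (auto simp: Basis_vec_def inner_axis)
    show ?thesis unfolding feature_def by measurable
  qed
  ultimately have "indep_vars (\<lambda>_. borel)
      (\<lambda>i w. ?Y i (restrict (\<lambda>k. (\<lambda>(i, j). x i j) k w) ({i} \<times> UNIV))) UNIV"
    by (rule indep_vars_compose2)
  then show ?thesis by simp
qed

lemma (in prob_space) indep_vars_imp_indep_var:
  assumes indep: "indep_vars (\<lambda>_. borel) X I" and "i \<in> I" "j \<in> I" "i \<noteq> j"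
  shows "indep_var borel (X i) borel (X j)"
proof -
  have "indep_var (PiM {i} (\<lambda>_. borel)) (\<lambda>w. restrict (\<lambda>i. X i w) {i})
      (PiM {j} (\<lambda>_. borel)) (\<lambda>w. restrict (\<lambda>i. X i w) {j})"
    using assms by (intro indep_var_restrict[OF indep]) auto
  from indep_var_compose[OF this, of "\<lambda>v. v i" borel "\<lambda>v. v j" borel]
  show ?thesis by (simp add: comp_def)
qed

lemma measurable_A0_A1_edm:
  fixes p :: "'w \<Rightarrow> 'n::finite \<Rightarrow> real ^ 'd"
  assumes p: "\<And>i j. (\<lambda>w. p w i $ j) \<in> borel_measurable M"
  shows "{w \<in> space M. A0 r mu0 (edm (p w)) \<and> A1 r mu1 (edm (p w))} \<in> sets M"
proof -
  note [measurable] = p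
  have "(\<lambda>w. edm (p w) $ i $ j) \<in> borel_measurable M" for i j
    by (simp add: edm_def power2_norm_eq_inner inner_vec_def)
  then have [measurable]: "(\<lambda>w. polar (edm (p w)) $ i $ j) \<in> borel_measurable M" for i j
    by (rule borel_measurable_polar)
  show ?thesis
    unfolding A0_symmetric_iff[OF transpose_edm] A1_symmetric_iff[OF transpose_edm]
    by measurable
qed

theorem theorem2:
  fixes \<Omega> :: "'w measure"
    and P :: "real measure"
    and x :: "'n::finite \<Rightarrow> 'd::finite \<Rightarrow> 'w \<Rightarrow> real"
    and p :: "'w \<Rightarrow> 'n \<Rightarrow> real ^ 'd"
    and N d :: nat
    and a b c \<alpha>0 \<alpha>1 \<alpha>2 \<alpha>3 \<theta> lam_star :: real
    and m :: "nat \<Rightarrow> real"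
    and lam1 lam2 lam3 :: complex
  assumes N: "N = CARD('n)" and d: "d = CARD('d)"
    and ab: "a < 0" "0 < b"
    and prob: "prob_space \<Omega>"
    and indep: "prob_space.indep_vars \<Omega> (\<lambda>_. borel) (\<lambda>(i, j). x i j) UNIV"
    and law: "\<And>i j. distr \<Omega> borel (x i j) = P"
    and atomless: "atomless P"
    and bounded: "\<And>i j. AE \<omega> in \<Omega>. x i j \<omega> \<in> {a..b}"
    and m: "\<And>k. m k = (\<integral>s. s ^ k \<partial>P)"
    and m1: "m 1 = 0"
    and p: "\<And>\<omega> i. p \<omega> i = (\<chi> j. x i j \<omega>)"
    and c: "c = max \<bar>a\<bar> \<bar>b\<bar>"
    and \<alpha>0: "\<alpha>0 = (m 4 * m 2 - m 2 ^ 3 - m 3 ^ 2) * real d"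
    and \<alpha>1: "\<alpha>1 = - (m 2 ^ 3) * real d ^ 2
                 + (m 2 ^ 3 + m 3 ^ 2 + m 2 ^ 2 - m 4 - m 4 * m 2) * real d - m 2"
    and \<alpha>2: "\<alpha>2 = m 2 ^ 2 * real d ^ 2 + (m 4 - m 2 ^ 2) * real d + m 2 + 1"
    and \<alpha>3: "\<alpha>3 = - 1"
    and solutions: "proots [:complex_of_real \<alpha>0, complex_of_real \<alpha>1,
                             complex_of_real \<alpha>2, complex_of_real \<alpha>3:] = {#lam1, lam2, lam3#}"
    and lam_star: "lam_star = Min {Re lam1, Re lam2, Re lam3, m 2}"
    and \<theta>: "\<theta> = (1 + real d * c ^ 2 + real d ^ 2 * c ^ 4) / lam_star"
  shows "(\<forall>z\<in>{lam1, lam2, lam3}. z \<in> \<real> \<and> 0 < Re z) \<and>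
    (\<forall>t \<gamma> :: real. 0 < t \<and> t < 1 \<and> 0 < \<gamma> \<and> \<gamma> \<le> 1 \<and>
       real N \<ge> 2 * \<theta> * (ln (real (d + 2)) - ln \<gamma>) / (1 - t) ^ 2 \<longrightarrow>
       measure \<Omega> {\<omega> \<in> space \<Omega>.
           A0 (d + 2) (\<theta> / (t * real (d + 2))) (edm (p \<omega>)) \<and>
           A1 (d + 2) (\<theta> / (t * sqrt (real (d + 2)))) (edm (p \<omega>))} \<ge> 1 - \<gamma>)"
proof -
  interpret prob_space \<Omega> by (rule prob)
  define R where "R = 1 + real d * c ^ 2 + real d ^ 2 * c ^ 4"
  have c0: "0 < c" using ab by (auto simp: c)
  have R: "0 < R" using c0 by (simp add: R_def add_pos_nonneg)
  have d1: "1 \<le> real d" using d by (simp add: Suc_leI)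
  have N0: "0 < real N" using N by simp
  have x_meas [measurable]: "x i j \<in> borel_measurable \<Omega>" for i j
    using indep unfolding indep_vars_def by force
  have abs_x: "AE \<omega> in \<Omega>. \<bar>x i j \<omega>\<bar> \<le> c" for i j
    using bounded[of i j] by eventually_elim (auto simp: c)
  have int: "integrable \<Omega> (\<lambda>\<omega>. x i j \<omega> ^ k)" for i j k
  proof (rule integrable_const_bound[where B = "c ^ k"])
    show "AE \<omega> in \<Omega>. norm (x i j \<omega> ^ k) \<le> c ^ k"
      using abs_x[of i j] by eventually_elim (simp add: power_abs power_mono)
  qed simp
  have moment: "expectation (\<lambda>\<omega>. x i j \<omega> ^ k) = m k" for i j k
    unfolding m law[of i j, symmetric] by (rule integral_distr[symmetric]) auto
  have P: "prob_space P" "sets P = sets borel" and intP: "integrable P (\<lambda>s. s ^ k)" for k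
    \<comment> \<open>All coordinates have the law \<open>P\<close>, so an arbitrary index pair
      serves.\<close>
    unfolding law[of undefined undefined, symmetric]
    by (auto simp: integrable_distr_eq int intro!: prob_space_distr)
  note bounds = atomless_moment_bounds[OF atomless P intP m m1]
  interpret cubic: moment_cubic "m 2" "m 3" "m 4" "real d" \<alpha>0 \<alpha>1 \<alpha>2
    by unfold_locales (use d1 bounds \<alpha>0 \<alpha>1 \<alpha>2 in auto)
  let ?p = "[:complex_of_real \<alpha>0, complex_of_real \<alpha>1, complex_of_real \<alpha>2, complex_of_real \<alpha>3:]"
  have "?p \<noteq> 0" using \<alpha>3 by simp
  then have "set_mset (proots ?p) = {z. poly ?p z = 0}" by (rule set_count_proots)
  moreover have "set_mset (proots ?p) = {lam1, lam2, lam3}" unfolding solutions by simp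
  moreover have "poly ?p z = complex_of_real \<alpha>0 + complex_of_real \<alpha>1 * z + complex_of_real \<alpha>2 * z\<^sup>2 - z ^ 3" for z
    by (simp add: \<alpha>3 power2_eq_square power3_eq_cube algebra_simps)
  ultimately have roots: "{lam1, lam2, lam3} = {z. complex_of_real \<alpha>0 + complex_of_real \<alpha>1 * z + complex_of_real \<alpha>2 * z\<^sup>2 - z ^ 3 = 0}"
    by (simp only:)
  have roots_pos: "z \<in> \<real> \<and> 0 < Re z" if "z \<in> {lam1, lam2, lam3}" for z
    using that cubic.complex_root unfolding roots by blast
  have lam_pos: "0 < lam_star"
    using roots_pos bounds(1) by (simp add: lam_star)
  have lam_le: "lam_star \<le> y" if "cubic.f y = 0" for y
  proof -
    have "complex_of_real (cubic.f y) = 0" using that by simp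
    then have "complex_of_real y \<in> {lam1, lam2, lam3}"
      unfolding roots cubic.f_def by simp
    then have "y \<in> {Re lam1, Re lam2, Re lam3}" by auto
    then show ?thesis unfolding lam_star by (intro Min_le) auto
  qed
  have lam_m2: "lam_star \<le> m 2" unfolding lam_star by (intro Min_le) auto
  have indep_ij: "indep_var borel (x i j) borel (x i k)" if "j \<noteq> k" for i j k
    using indep_vars_imp_indep_var[OF indep, of "(i, j)" "(i, k)"] that by simp
  have p': "p \<omega> i = (\<chi> j. x i j \<omega>)" for \<omega> i by (rule p)
  have second: "lam_star * (z \<bullet> z) \<le> expectation (\<lambda>\<omega>. (feature (p \<omega> i) \<bullet> z)\<^sup>2)" for i z
  proof (cases z)
    case (fields z0 y z1)
    let ?Y = "\<Sum>j\<in>UNIV. y $ j"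
    have Y: "?Y\<^sup>2 \<le> real d * (y \<bullet> y)"
      using sum_squared_le_sum_of_squares[of "\<lambda>j. y $ j" UNIV]
      by (simp add: d inner_vec_def power2_eq_square mult.commute)
    have E: "expectation (\<lambda>\<omega>. (feature (p \<omega> i) \<bullet> z)\<^sup>2)
      = z0\<^sup>2 + m 2 * (y \<bullet> y) + cubic.q * z1\<^sup>2 + 2 * (real d * m 2) * z0 * z1 + 2 * m 3 * z1 * ?Y"
      unfolding cubic.q_def unfolding p' fields d
      by (rule feature_second_moment[OF indep_ij int moment m1])
    show ?thesis
    proof (rule le_if_all_smaller_multiples_le)
      fix \<mu> assume \<mu>: "\<mu> < lam_star"
      have "0 \<le> (1 - \<mu>) * z0\<^sup>2 + (m 2 - \<mu>) * (y \<bullet> y) + (cubic.q - \<mu>) * z1\<^sup>2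
          + 2 * (real d * m 2) * z0 * z1 + 2 * m 3 * z1 * ?Y"
        using \<mu> lam_le lam_m2 Y by (intro cubic.quadratic_form_nonneg) force+
      then show "\<mu> * (z \<bullet> z) \<le> expectation (\<lambda>\<omega>. (feature (p \<omega> i) \<bullet> z)\<^sup>2)"
        unfolding E by (simp add: fields power2_eq_square algebra_simps)
    qed simp
  qed
  have AE_R: "AE \<omega> in \<Omega>. feature (p \<omega> i) \<bullet> feature (p \<omega> i) \<le> R" for i
  proof -
    have "AE \<omega> in \<Omega>. \<forall>j. \<bar>x i j \<omega>\<bar> \<le> c" using abs_x by (simp add: AE_all_countable)
    then show ?thesis
      by eventually_elim (simp add: R_def d p' inner_feature_self_le)
  qed
  interpret vecs: bounded_indep_vectors \<Omega> "\<lambda>i \<omega>. feature (p \<omega> i)" R lam_star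
    using indep_vars_feature[OF indep] AE_R R lam_pos second by unfold_locales (auto simp: p')
  have \<theta>': "\<theta> = R / lam_star" by (simp add: \<theta> R_def)
  have \<theta>_pos: "0 < \<theta>" using R lam_pos by (simp add: \<theta>')
  have "1 - \<gamma> \<le> prob {\<omega> \<in> space \<Omega>.
           A0 (d + 2) (\<theta> / (t * real (d + 2))) (edm (p \<omega>)) \<and>
           A1 (d + 2) (\<theta> / (t * sqrt (real (d + 2)))) (edm (p \<omega>))}" (is "_ \<le> prob ?A")
    if t: "0 < t" "t < 1" and \<gamma>: "0 < \<gamma>"
      and N_ge: "2 * \<theta> * (ln (real (d + 2)) - ln \<gamma>) / (1 - t) ^ 2 \<le> real N" for t \<gamma>
  proof -
    define \<tau> where "\<tau> = t * real N * lam_star"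
    have \<tau>: "0 < \<tau>" using t N0 lam_pos by (simp add: \<tau>_def)
    \<comment> \<open>The common bound on leverages and entries. Multiplied by
      \<open>N / (d + 2)\<close> it is the constant of \<open>A0\<close>; the constant of
      \<open>A1\<close> times \<open>sqrt ((d + 2) / N^2)\<close> equals it.\<close>
    have \<rho>: "R / \<tau> = \<theta> / (t * real N)" by (simp add: \<tau>_def \<theta>' mult_ac)
    have "?A \<in> events"
      by (rule measurable_A0_A1_edm) (simp add: p')
    moreover have "AE \<omega> in \<Omega>. (\<forall>z. t * real CARD('n) * lam_star * (z \<bullet> z)
        \<le> (\<Sum>i\<in>UNIV. (feature (p \<omega> i) \<bullet> z)\<^sup>2)) \<longrightarrow> \<omega> \<in> ?A"
      using vecs.AE_bound AE_space
    proof eventually_elim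
      case (elim \<omega>)
      show ?case
      proof
        assume good: "\<forall>z. t * real CARD('n) * lam_star * (z \<bullet> z) \<le> (\<Sum>i\<in>UNIV. (feature (p \<omega> i) \<bullet> z)\<^sup>2)"
        have row: "((edm (p \<omega>) *v y) $ k)\<^sup>2 \<le> R / \<tau> * ((edm (p \<omega>) *v y) \<bullet> (edm (p \<omega>) *v y))" for y k
          using elim(1) good \<tau> by (intro edm_row_le) (auto simp: \<tau>_def N)
        have \<rho>0: "0 \<le> R / \<tau>" using R \<tau> by simp
        note le = polar_symmetric_entries_le[OF transpose_edm \<rho>0 row]
        have "(MAX i. \<Sum>j\<in>UNIV. (polar (edm (p \<omega>)) $ i $ j)\<^sup>2) \<le> R / \<tau>"
          using le(1) by (subst Max_le_iff) auto
        then have "real CARD('n) / real (d + 2) * (MAX i. \<Sum>j\<in>UNIV. (polar (edm (p \<omega>)) $ i $ j)\<^sup>2)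
            \<le> real N / real (d + 2) * (R / \<tau>)"
          unfolding N by (rule mult_left_mono) simp
        also have "\<dots> = \<theta> / (t * real (d + 2))"
          using N0 by (simp add: \<rho> mult_ac)
        finally have "A0 (d + 2) (\<theta> / (t * real (d + 2))) (edm (p \<omega>))"
          unfolding A0_symmetric_iff[OF transpose_edm] .
        moreover have "\<theta> / (t * sqrt (real (d + 2))) * sqrt (real (d + 2) / (real CARD('n) * real CARD('n))) = R / \<tau>"
          unfolding \<rho> by (simp add: real_sqrt_divide N[symmetric])
        then have "A1 (d + 2) (\<theta> / (t * sqrt (real (d + 2)))) (edm (p \<omega>))"
          unfolding A1_symmetric_iff[OF transpose_edm] using le(2) by simp
        ultimately show "\<omega> \<in> ?A" using elim(2) by simp
      qed
    qed
    ultimately have "1 - real DIM(real \<times> (real ^ 'd) \<times> real)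
        * exp (- ((1 - t)\<^sup>2 * real CARD('n) * lam_star / (2 * R))) \<le> prob ?A"
      by (rule vecs.matrix_chernoff_lower[OF t])
    moreover have DIM: "real DIM(real \<times> (real ^ 'd) \<times> real) = real (d + 2)"
      by (simp add: d)
    moreover have "real (d + 2) * exp (- ((1 - t)\<^sup>2 * real CARD('n) * lam_star / (2 * R))) \<le> \<gamma>"
    proof -
      \<comment> \<open>The sample size condition solved for the exponent, so that the factor
        \<open>d + 2\<close> is absorbed and the failure probability is at most \<gamma>.\<close>
      have "ln (real (d + 2)) - ln \<gamma> \<le> (1 - t)\<^sup>2 * real N / (2 * \<theta>)"
        using N_ge t \<theta>_pos by (simp add: field_simps)
      also have "\<dots> = (1 - t)\<^sup>2 * real CARD('n) * lam_star / (2 * R)"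
        by (simp add: \<theta>' N)
      finally have "exp (- ((1 - t)\<^sup>2 * real CARD('n) * lam_star / (2 * R))) \<le> exp (ln \<gamma> - ln (real (d + 2)))"
        by simp
      also have "\<dots> = \<gamma> / real (d + 2)" using \<gamma> by (simp add: exp_diff)
      finally show ?thesis by (simp add: field_simps)
    qed
    ultimately show ?thesis unfolding DIM by linarith
  qed
  with roots_pos show ?thesis by blast
qed

end
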